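(* Let $R$ be a commutative ring and $V$ an $R$-module equipped with a bilinear operation $[,]:V\otimes V\to V$. Put $\overline{V}:=V\oplus R\mathbf{1}$. Define linear maps $\Delta_{Lei}:\overline{V}\to\overline{V}\otimes\overline{V}$ and $\varepsilon_{Lei}:\overline{V}\to R$ by $$\Delta_{Lei}(v)=v\otimes\mathbf{1}+\mathbf{1}\otimes v,\quad\varepsilon_{Lei}(v)=0\quad(v\in V),\qquad\Delta_{Lei}(\mathbf{1})=\mathbf{1}\otimes\mathbf{1},\quad\varepsilon_{Lei}(\mathbf{1})=1,$$ and bilinear operations $\lhd_{Lei},\widetilde{\lhd}_{Lei}$ on $\overline{V}$ by $$v\lhd_{Lei}w=-v\,\widetilde{\lhd}_{Lei}\,w=[v,w]\ (v,w\in V),\quad v\lhd_{Lei}\mathbf{1}=v\,\widetilde{\lhd}_{Lei}\,\mathbf{1}=v\ (v\in\overline{V}),\quad\mathbf{1}\lhd_{Lei}v=\mathbf{1}\,\widetilde{\lhd}_{Lei}\,v=0\ (v\in V).$$ Then $(\overline{V},\Delta_{Lei},\varepsilon_{Lei},\lhd_{Lei},\widetilde{\lhd}_{Lei})$ satisfies all the conditions in the definition of a rack in the symmetric category of $R$-modules (usual tensor product, flip as braiding) except possibly generalized self-distributivity (GSD), and GSD is equivalent to the Leibniz condition $$[v,[w,u]]=[[v,w],u]-[[v,u],w]\qquad\forall v,w,u\in V.$$ Moreover, if $(V,[,])$ is a Leibniz algebra (i.e. the Leibniz condition holds), then the braiding $\sigma=(\lhd_{Lei})_2\circ c_1\circ(\Delta_{Lei})_2$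 on $\overline{V}$ coincides with $$\sigma_{\overline{V},[,]}:a\otimes b\mapsto b\otimes a+\mathbf{1}\otimes[a,b],$$ where $[,]$ is extended to $\overline{V}$ by $[\mathbf{1},v]=[v,\mathbf{1}]=0$ for all $v\in\overline{V}$.
   Context: For $\varphi:V^{\otimes l}\to V^{\otimes r}$, $\varphi_i:=\operatorname{Id}_V^{\otimes(i-1)}\otimes\varphi\otimes\operatorname{Id}_V^{\otimes(k-i+1)}:V^{\otimes(k+l)}\to V^{\otimes(k+r)}$, and $\varphi^n:=\varphi_1\circ\cdots\circ\varphi_1$ ($n$ times). In a symmetric category $(\mathcal{C},\otimes,\mathbf{I},c)$ (strict symmetric monoidal; here $R$-modules with the usual identifications and $c$ the flip $v\otimes w\mapsto w\otimes v$): A shelf is an object $V$ with $\Delta:V\to V\otimes V$, $\lhd:V\otimes V\to V$ such that: (1) $\Delta_1\circ\Delta=\Delta_2\circ\Delta$ and $c_2\circ\Delta^3=\Delta^3:V\to V^{\otimes4}$; (2) (GSD) $\lhd^2=\lhd\circ(\lhd\otimes\lhd)\circ c_2\circ\Delta_3:V^{\otimes3}\to V$; (3) $\Delta\circ\lhd=(\lhd\otimes\lhd)\circ c_2\circ(\Delta\otimes\Delta)$. A rack is a shelf with moreover $\varepsilon:V\to\mathbf{I}$ satisfying $\varepsilon_2\circ\Delta=\operatorname{Id}_V$, and $\widetilde{\lhd}:V\otimes V\to V$ with $\widetilde{\lhd}\circ\lhd_1\circ c_2\circ\Delta_2=\lhd\circ\widetilde{\lhd}_1\circ c_2\circ\Delta_2=\operatorname{Id}_V\otimes\varepsilon:V^{\otimes2}\to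 V$. *)

theory Defs
  imports "HOL-Algebra.Module" "HOL-Algebra.AbelCoset" "HOL-Library.FuncSet"
begin

section \<open>Linear maps, free modules, quotient modules\<close>

definition linear_maps ::
    "('r, 'k) ring_scheme \<Rightarrow> ('r, 'a, 'm) module_scheme \<Rightarrow> ('r, 'b, 'n) module_scheme
      \<Rightarrow> ('a \<Rightarrow> 'b) set"
  where "linear_maps R M N =
    {h. h \<in> carrier M \<rightarrow> carrier N \<and>
        (\<forall>x\<in>carrier M. \<forall>y\<in>carrier M. h (x \<oplus>\<^bsub>M\<^esub> y) = h x \<oplus>\<^bsub>N\<^esub> h y) \<and>
        (\<forall>r\<in>carrier R. \<forall>x\<in>carrier M. h (r \<odot>\<^bsub>M\<^esub> x) = r \<odot>\<^bsub>N\<^esub> h x)}"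

definition bilinear_op ::
    "('r, 'k) ring_scheme \<Rightarrow> ('r, 'a, 'm) module_scheme \<Rightarrow> ('a \<Rightarrow> 'a \<Rightarrow> 'a) \<Rightarrow> bool"
  where "bilinear_op R M b \<longleftrightarrow>
    (\<forall>x\<in>carrier M. (\<lambda>y. b x y) \<in> linear_maps R M M) \<and>
    (\<forall>y\<in>carrier M. (\<lambda>x. b x y) \<in> linear_maps R M M)"

text \<open>
  The \<open>mult\<close> and \<open>one\<close> fields of a module record are irrelevant for modules and left
  unspecified throughout.
\<close>

definition free_module :: "('r, 'k) ring_scheme \<Rightarrow> 'x set \<Rightarrow> ('r, 'x \<Rightarrow> 'r) module"
  where "free_module R X =
    \<lparr>carrier = {p. (\<forall>x. p x \<in> carrier R) \<and> (\<forall>x. x \<notin> X \<longrightarrow> p x = \<zero>\<^bsub>R\<^esub>) \<and> finite {x. p x \<noteq> \<zero>\<^bsub>R\<^esub>}},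
     mult = undefined, one = undefined,
     zero = (\<lambda>x. \<zero>\<^bsub>R\<^esub>), add = (\<lambda>p q x. p x \<oplus>\<^bsub>R\<^esub> q x),
     smult = (\<lambda>r p x. r \<otimes>\<^bsub>R\<^esub> p x)\<rparr>"

definition free_gen :: "('r, 'k) ring_scheme \<Rightarrow> 'x \<Rightarrow> 'x \<Rightarrow> 'r"
  where "free_gen R x = (\<lambda>y. if y = x then \<one>\<^bsub>R\<^esub> else \<zero>\<^bsub>R\<^esub>)"

definition generated_submodule ::
    "('r, 'k) ring_scheme \<Rightarrow> ('r, 'a, 'm) module_scheme \<Rightarrow> 'a set \<Rightarrow> 'a set"
  where "generated_submodule R M G = \<Inter>{N. submodule N R M \<and> G \<subseteq> N}"

definition quotient_module :: "('r, 'a, 'm) module_scheme \<Rightarrow> 'a set \<Rightarrow> ('r, 'a set) module"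
  where "quotient_module M K =
    \<lparr>carrier = a_rcosets\<^bsub>M\<^esub> K, mult = undefined, one = undefined,
     zero = K, add = set_add M,
     smult = (\<lambda>r A. \<Union>x\<in>A. K +>\<^bsub>M\<^esub> (r \<odot>\<^bsub>M\<^esub> x))\<rparr>"


section \<open>Tensor powers\<close>

text \<open>
  To have the monoidal structure strict, the tensor power \<open>M\<^sup>\<otimes>\<^sup>n\<close> is built directly from
  \<open>n\<close>-tuples, as the free module on them modulo multilinearity; \<open>M\<^sup>\<otimes>\<^sup>0\<close> is free on the empty
  tuple and stands for the unit object \<open>R\<close>, and \<open>M\<^sup>\<otimes>\<^sup>1\<close> stands for \<open>M\<close>. The
  identifications are \<open>r \<mapsto> r \<odot> pure []\<close> and \<open>x \<mapsto> pure [x]\<close>. Juxtaposition of tuples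
  makes \<open>M\<^sup>\<otimes>\<^sup>m \<otimes> M\<^sup>\<otimes>\<^sup>n = M\<^sup>\<otimes>\<^sup>(\<^sup>m\<^sup>+\<^sup>n\<^sup>)\<close> an equality.
\<close>

definition tuples :: "('a, 'm) partial_object_scheme \<Rightarrow> nat \<Rightarrow> 'a list set"
  where "tuples M n = {xs. set xs \<subseteq> carrier M \<and> length xs = n}"

abbreviation tuple_module ::
    "('r, 'k) ring_scheme \<Rightarrow> ('r, 'a, 'm) module_scheme \<Rightarrow> nat \<Rightarrow> ('r, 'a list \<Rightarrow> 'r) module"
  where "tuple_module R M n \<equiv> free_module R (tuples M n)"

definition multilinear_relations ::
    "('r, 'k) ring_scheme \<Rightarrow> ('r, 'a, 'm) module_scheme \<Rightarrow> nat \<Rightarrow> ('a list \<Rightarrow> 'r) set"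
  where "multilinear_relations R M n = generated_submodule R (tuple_module R M n)
    ({free_gen R (xs @ (x \<oplus>\<^bsub>M\<^esub> y) # ys)
        \<ominus>\<^bsub>tuple_module R M n\<^esub> (free_gen R (xs @ x # ys) \<oplus>\<^bsub>tuple_module R M n\<^esub> free_gen R (xs @ y # ys))
      | xs x y ys. x \<in> carrier M \<and> y \<in> carrier M \<and>
          set (xs @ ys) \<subseteq> carrier M \<and> length xs + 1 + length ys = n} \<union>
     {free_gen R (xs @ (r \<odot>\<^bsub>M\<^esub> x) # ys)
        \<ominus>\<^bsub>tuple_module R M n\<^esub> (r \<odot>\<^bsub>tuple_module R M n\<^esub> free_gen R (xs @ x # ys))
      | xs r x ys. r \<in> carrier R \<and> x \<in> carrier M \<and>
          set (xs @ ys) \<subseteq> carrier M \<and> length xs + 1 + length ys = n})"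

definition tensor_power ::
    "('r, 'k) ring_scheme \<Rightarrow> ('r, 'a, 'm) module_scheme \<Rightarrow> nat \<Rightarrow> ('r, ('a list \<Rightarrow> 'r) set) module"
  where "tensor_power R M n =
    quotient_module (tuple_module R M n) (multilinear_relations R M n)"

text \<open>\<open>pure R M [x\<^sub>1, \<dots>, x\<^sub>n]\<close> is \<open>x\<^sub>1 \<otimes> \<dots> \<otimes> x\<^sub>n\<close>.\<close>

definition pure ::
    "('r, 'k) ring_scheme \<Rightarrow> ('r, 'a, 'm) module_scheme \<Rightarrow> 'a list \<Rightarrow> ('a list \<Rightarrow> 'r) set"
  where "pure R M xs =
    multilinear_relations R M (length xs) +>\<^bsub>tuple_module R M (length xs)\<^esub> free_gen R xs"

text \<open>
  The product \<open>M\<^sup>\<otimes>\<^sup>m \<times> M\<^sup>\<otimes>\<^sup>n \<rightarrow> M\<^sup>\<otimes>\<^sup>(\<^sup>m\<^sup>+\<^sup>n\<^sup>)\<close> with \<open>pure xs \<otimes> pure ys = pure (xs @ ys)\<close>. On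
  representatives it is the bilinear extension of concatenation: only the splitting of a tuple
  of length \<open>m + n\<close> at position \<open>m\<close> contributes.
\<close>

definition tensor_mult ::
    "('r, 'k) ring_scheme \<Rightarrow> ('r, 'a, 'm) module_scheme \<Rightarrow> nat \<Rightarrow> nat
      \<Rightarrow> ('a list \<Rightarrow> 'r) set \<Rightarrow> ('a list \<Rightarrow> 'r) set \<Rightarrow> ('a list \<Rightarrow> 'r) set"
  where "tensor_mult R M m n A B =
    (\<Union>p\<in>A. \<Union>q\<in>B. multilinear_relations R M (m + n) +>\<^bsub>tuple_module R M (m + n)\<^esub>
      (\<lambda>zs. p (take m zs) \<otimes>\<^bsub>R\<^esub> q (drop m zs)))"

text \<open>
  The linear map \<open>M\<^sup>\<otimes>\<^sup>n \<rightarrow> N\<close> sending \<open>pure xs\<close> to \<open>f xs\<close>; it exists and is unique when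
  \<open>f\<close> is multilinear on \<open>n\<close>-tuples.
\<close>

definition tensor_lift ::
    "('r, 'k) ring_scheme \<Rightarrow> ('r, 'a, 'm) module_scheme \<Rightarrow> ('r, 'b, 'n) module_scheme \<Rightarrow> nat
      \<Rightarrow> ('a list \<Rightarrow> 'b) \<Rightarrow> ('a list \<Rightarrow> 'r) set \<Rightarrow> 'b"
  where "tensor_lift R M N n f =
    (THE h. h \<in> linear_maps R (tensor_power R M n) N \<and>
            h \<in> extensional (carrier (tensor_power R M n)) \<and>
            (\<forall>xs\<in>tuples M n. h (pure R M xs) = f xs))"

text \<open>Well-definedness of \<open>tensor_lift\<close>.\<close>

lemma free_module_module:
  fixes R :: "('a,'k) ring_scheme" and X :: "'b set"
  assumes "cring R" shows "module R (free_module R X)"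
proof -
  interpret cring R by fact
  let ?F = "free_module R X"
  have fin: "finite {x. p x \<oplus>\<^bsub>R\<^esub> q x \<noteq> \<zero>\<^bsub>R\<^esub>}" if "finite {x. p x \<noteq> \<zero>\<^bsub>R\<^esub>}" "finite {x. q x \<noteq> \<zero>\<^bsub>R\<^esub>}" for p q :: "'b \<Rightarrow> 'a"
    by (rule finite_subset[OF _ finite_UnI[OF that]]) auto
  have fin2: "finite {x. r \<otimes>\<^bsub>R\<^esub> p x \<noteq> \<zero>\<^bsub>R\<^esub>}" if "finite {x. p x \<noteq> \<zero>\<^bsub>R\<^esub>}" "r \<in> carrier R" for p :: "'b \<Rightarrow> 'a" and r
    by (rule finite_subset[OF _ that(1)]) (use that in auto)
  have ag: "abelian_group ?F"
  proof (rule abelian_groupI)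
    fix p assume p: "p \<in> carrier ?F"
    show "\<exists>y\<in>carrier ?F. y \<oplus>\<^bsub>?F\<^esub> p = \<zero>\<^bsub>?F\<^esub>"
    proof (rule bexI[of _ "\<lambda>x. \<ominus>\<^bsub>R\<^esub> p x"])
      show "(\<lambda>x. \<ominus>\<^bsub>R\<^esub> p x) \<in> carrier ?F" using p
        by (auto simp: free_module_def elim: finite_subset[rotated])
    qed (use p in \<open>auto simp: free_module_def l_neg\<close>)
  qed (auto simp: free_module_def fin a_assoc a_comm a_lcomm)
  show ?thesis
    by (rule moduleI[OF assms ag]) (auto simp: free_module_def fin2 l_distr r_distr m_assoc)
qed

lemma submodule_generated:
  assumes "module R M" "G \<subseteq> carrier M"
  shows "submodule (generated_submodule R M G) R M"
proof -
  interpret module R M by fact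
  show ?thesis
  proof (intro submoduleI)
    show "generated_submodule R M G \<subseteq> carrier M"
      using carrier_is_submodule assms(2) unfolding generated_submodule_def by blast
    show "\<zero>\<^bsub>M\<^esub> \<in> generated_submodule R M G"
      using subgroup.one_closed[OF submodule.axioms(1)] unfolding generated_submodule_def by fastforce
  qed (auto simp: generated_submodule_def submoduleE submodule.smult_closed)
qed

lemma generated_submodule_incl: "G \<subseteq> generated_submodule R M G"
  by (auto simp: generated_submodule_def)

lemma quotient_module_module:
  assumes "module R M" "submodule K R M"
  shows "module R (quotient_module M K)"
    and "\<And>x y. x \<in> carrier M \<Longrightarrow> y \<in> carrier M \<Longrightarrow>
      (K +>\<^bsub>M\<^esub> x) \<oplus>\<^bsub>quotient_module M K\<^esub> (K +>\<^bsub>M\<^esub> y) = K +>\<^bsub>M\<^esub> (x \<oplus>\<^bsub>M\<^esub> y)"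
    and "\<And>r x. r \<in> carrier R \<Longrightarrow> x \<in> carrier M \<Longrightarrow>
      r \<odot>\<^bsub>quotient_module M K\<^esub> (K +>\<^bsub>M\<^esub> x) = K +>\<^bsub>M\<^esub> (r \<odot>\<^bsub>M\<^esub> x)"
    and "carrier (quotient_module M K) = (\<lambda>x. K +>\<^bsub>M\<^esub> x) ` carrier M"
proof -
  interpret module R M by fact
  interpret S: submodule K R M by fact
  have as: "additive_subgroup K M" by (simp add: additive_subgroup_def S.subgroup_axioms)
  interpret A: abelian_subgroup K M
    by (rule abelian_subgroupI3[OF as]) (rule abelian_group_axioms)
  let ?Q = "quotient_module M K"
  show c: "carrier ?Q = (\<lambda>x. K +>\<^bsub>M\<^esub> x) ` carrier M"
    by (auto simp: quotient_module_def A_RCOSETS_def' )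
  show a: "(K +>\<^bsub>M\<^esub> x) \<oplus>\<^bsub>?Q\<^esub> (K +>\<^bsub>M\<^esub> y) = K +>\<^bsub>M\<^esub> (x \<oplus>\<^bsub>M\<^esub> y)" if "x \<in> carrier M" "y \<in> carrier M" for x y
    using that by (simp add: quotient_module_def A.a_rcos_sum)
  show s: "r \<odot>\<^bsub>?Q\<^esub> (K +>\<^bsub>M\<^esub> x) = K +>\<^bsub>M\<^esub> (r \<odot>\<^bsub>M\<^esub> x)" if r: "r \<in> carrier R" and x: "x \<in> carrier M" for r x
  proof -
    have "K +>\<^bsub>M\<^esub> (r \<odot>\<^bsub>M\<^esub> y) = K +>\<^bsub>M\<^esub> (r \<odot>\<^bsub>M\<^esub> x)" if y: "y \<in> K +>\<^bsub>M\<^esub> x" for y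
    proof -
      obtain k where k: "k \<in> K" "y = k \<oplus>\<^bsub>M\<^esub> x" using y by (auto simp: a_r_coset_def')
      have kc: "k \<in> carrier M" using k A.a_subset by auto
      have "r \<odot>\<^bsub>M\<^esub> y \<in> K +>\<^bsub>M\<^esub> (r \<odot>\<^bsub>M\<^esub> x)"
        unfolding k(2) a_r_coset_def' using k kc r x by (auto simp: smult_r_distr)
      then show ?thesis using M.a_repr_independence r x
        by (metis M.a_repr_independence A.a_subgroup smult_closed)
    qed
    moreover have "x \<in> K +>\<^bsub>M\<^esub> x" using x A.a_rcos_self by blast
    ultimately have "(\<Union>y\<in>K +>\<^bsub>M\<^esub> x. K +>\<^bsub>M\<^esub> (r \<odot>\<^bsub>M\<^esub> y)) = K +>\<^bsub>M\<^esub> (r \<odot>\<^bsub>M\<^esub> x)"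
      by blast
    then show ?thesis by (simp add: quotient_module_def)
  qed
  have z: "\<zero>\<^bsub>?Q\<^esub> = K +>\<^bsub>M\<^esub> \<zero>\<^bsub>M\<^esub>" using A.a_subset by (simp add: quotient_module_def)
  have ag: "abelian_group ?Q"
  proof (rule abelian_groupI)
    fix p assume p: "p \<in> carrier ?Q"
    then obtain x where "x \<in> carrier M" "p = K +>\<^bsub>M\<^esub> x" by (auto simp: c)
    then show "\<exists>y\<in>carrier ?Q. y \<oplus>\<^bsub>?Q\<^esub> p = \<zero>\<^bsub>?Q\<^esub>"
      by (intro bexI[of _ "K +>\<^bsub>M\<^esub> (\<ominus>\<^bsub>M\<^esub> x)"]) (auto simp: c a z M.l_neg)
  qed (auto simp: c a z M.a_ac)
  show "module R ?Q"
    by (rule moduleI[OF R.is_cring ag]) (auto simp: c a s smult_l_distr smult_r_distr smult_assoc1)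
qed


lemma free_gen_carrier:
  assumes "cring R" "x \<in> X" shows "free_gen R x \<in> carrier (free_module R X)"
proof -
  interpret cring R by fact
  have "finite {y. free_gen R x y \<noteq> \<zero>\<^bsub>R\<^esub>}"
    by (rule finite_subset[of _ "{x}"]) (auto simp: free_gen_def)
  then show ?thesis using assms by (auto simp: free_module_def free_gen_def)
qed

lemma free_extend:
  fixes R :: "('r,'k) ring_scheme" and N :: "('r,'b,'n) module_scheme" and f :: "'x \<Rightarrow> 'b"
  assumes N: "module R N" and f: "f \<in> X \<rightarrow> carrier N"
  defines "F \<equiv> \<lambda>p. finsum N (\<lambda>x. p x \<odot>\<^bsub>N\<^esub> f x) {x. p x \<noteq> \<zero>\<^bsub>R\<^esub>}"
  shows "F \<in> linear_maps R (free_module R X) N" and "\<And>x. x \<in> X \<Longrightarrow> F (free_gen R x) = f x"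
proof -
  interpret module R N by fact
  let ?F = "free_module R X"
  have nz: "x \<in> X" if "p \<in> carrier ?F" "p x \<noteq> \<zero>\<^bsub>R\<^esub>" for p x using that by (auto simp: free_module_def)
  have pc: "p x \<in> carrier R" if "p \<in> carrier ?F" for p x using that by (auto simp: free_module_def)
  have fx: "f x \<in> carrier N" if "x \<in> X" for x using f that by auto
  have fin: "finite {x. p x \<noteq> \<zero>\<^bsub>R\<^esub>}" if "p \<in> carrier ?F" for p using that by (auto simp: free_module_def)
  have any: "F p = finsum N (\<lambda>x. p x \<odot>\<^bsub>N\<^esub> f x) S"
    if "p \<in> carrier ?F" "finite S" "S \<subseteq> X" "{x. p x \<noteq> \<zero>\<^bsub>R\<^esub>} \<subseteq> S" for p S
    unfolding F_def
    by (rule M.add.finprod_mono_neutral_cong_left) (use that pc fx in auto)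
  have mod: "module R ?F" by (rule free_module_module) (rule R.is_cring)
  then interpret FF: module R ?F .
  show "F \<in> linear_maps R ?F N"
    unfolding linear_maps_def
  proof (intro CollectI conjI ballI)
    show "F \<in> carrier ?F \<rightarrow> carrier N"
      unfolding F_def by (auto intro!: M.finsum_closed fx pc dest: nz)
  next
    fix p q assume p: "p \<in> carrier ?F" and q: "q \<in> carrier ?F"
    let ?S = "{x. p x \<noteq> \<zero>\<^bsub>R\<^esub>} \<union> {x. q x \<noteq> \<zero>\<^bsub>R\<^esub>}"
    have S: "finite ?S" "?S \<subseteq> X" using p q fin nz by auto
    have e: "(p \<oplus>\<^bsub>?F\<^esub> q) x = p x \<oplus>\<^bsub>R\<^esub> q x" for x by (simp add: free_module_def)
    have pq: "p \<oplus>\<^bsub>?F\<^esub> q \<in> carrier ?F" using p q by simp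
    have c: "(\<lambda>x. p x \<odot>\<^bsub>N\<^esub> f x) \<in> ?S \<rightarrow> carrier N" "(\<lambda>x. q x \<odot>\<^bsub>N\<^esub> f x) \<in> ?S \<rightarrow> carrier N"
      using S p q pc fx by auto
    have "F (p \<oplus>\<^bsub>?F\<^esub> q) = finsum N (\<lambda>x. (p x \<oplus>\<^bsub>R\<^esub> q x) \<odot>\<^bsub>N\<^esub> f x) ?S"
      by (subst any[OF pq S]) (auto simp: e pc p q)
    also have "\<dots> = finsum N (\<lambda>x. p x \<odot>\<^bsub>N\<^esub> f x \<oplus>\<^bsub>N\<^esub> q x \<odot>\<^bsub>N\<^esub> f x) ?S"
      by (rule M.finsum_cong') (use S p q pc fx nz in \<open>auto simp: smult_l_distr\<close>)
    also have "\<dots> = F p \<oplus>\<^bsub>N\<^esub> F q"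
      by (subst M.finsum_addf[OF c]) (simp add: any[OF p S] any[OF q S])
    finally show "F (p \<oplus>\<^bsub>?F\<^esub> q) = F p \<oplus>\<^bsub>N\<^esub> F q" .
  next
    fix r p assume r: "r \<in> carrier R" and p: "p \<in> carrier ?F"
    let ?S = "{x. p x \<noteq> \<zero>\<^bsub>R\<^esub>}"
    have S: "finite ?S" "?S \<subseteq> X" using p fin nz by auto
    have e: "(r \<odot>\<^bsub>?F\<^esub> p) x = r \<otimes>\<^bsub>R\<^esub> p x" for x by (simp add: free_module_def)
    have pq: "r \<odot>\<^bsub>?F\<^esub> p \<in> carrier ?F" using p r by simp
    have c: "(\<lambda>x. p x \<odot>\<^bsub>N\<^esub> f x) \<in> ?S \<rightarrow> carrier N"
      using S p pc fx by auto
    have "F (r \<odot>\<^bsub>?F\<^esub> p) = finsum N (\<lambda>x. (r \<otimes>\<^bsub>R\<^esub> p x) \<odot>\<^bsub>N\<^esub> f x) ?S"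
      by (subst any[OF pq S]) (auto simp: e pc p r)
    also have "\<dots> = finsum N (\<lambda>x. r \<odot>\<^bsub>N\<^esub> (p x \<odot>\<^bsub>N\<^esub> f x)) ?S"
      by (rule M.finsum_cong') (use S p r pc fx nz in \<open>auto simp: smult_assoc1\<close>)
    also have "\<dots> = r \<odot>\<^bsub>N\<^esub> F p"
      by (subst finsum_smult_ldistr[OF S(1) r c, symmetric]) (simp add: any[OF p S])
    finally show "F (r \<odot>\<^bsub>?F\<^esub> p) = r \<odot>\<^bsub>N\<^esub> F p" .
  qed
  fix x assume x: "x \<in> X"
  have "F (free_gen R x) = finsum N (\<lambda>y. free_gen R x y \<odot>\<^bsub>N\<^esub> f y) {x}"
    by (rule any[OF free_gen_carrier[OF R.is_cring x]]) (use x in \<open>auto simp: free_gen_def\<close>)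
  also have "\<dots> = f x" using x fx by (simp add: free_gen_def)
  finally show "F (free_gen R x) = f x" .
qed

lemma linear_ext:
  assumes M: "module R (M)" and N: "module R N" and h: "h \<in> linear_maps R M N" "h' \<in> linear_maps R M N"
    and sub: "G \<subseteq> carrier M" and gen: "generated_submodule R M G = carrier M"
    and eq: "\<And>x. x \<in> G \<Longrightarrow> h x = h' x" and x: "x \<in> carrier M"
  shows "h x = h' x"
proof -
  interpret M: module R M by fact
  interpret N: module R N by fact
  have z: "h \<zero>\<^bsub>M\<^esub> = \<zero>\<^bsub>N\<^esub>" if "h \<in> linear_maps R M N" for h
    using that unfolding linear_maps_def
    by (smt (verit) M.M.zero_closed M.R.zero_closed M.smult_l_null N.smult_l_null PiE mem_Collect_eq)
  have neg: "h (\<ominus>\<^bsub>M\<^esub> x) = \<ominus>\<^bsub>N\<^esub> h x" if h: "h \<in> linear_maps R M N" "x \<in> carrier M" for h x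
  proof -
    have "h ((\<ominus>\<^bsub>R\<^esub> \<one>\<^bsub>R\<^esub>) \<odot>\<^bsub>M\<^esub> x) = (\<ominus>\<^bsub>R\<^esub> \<one>\<^bsub>R\<^esub>) \<odot>\<^bsub>N\<^esub> h x" "h x \<in> carrier N"
      using h unfolding linear_maps_def by auto
    then show ?thesis using h by (simp add: M.smult_l_minus N.smult_l_minus)
  qed
  have "submodule {x \<in> carrier M. h x = h' x} R M"
    by (rule M.submoduleI) (use h z[OF h(1)] z[OF h(2)] neg[OF h(1)] neg[OF h(2)] in \<open>auto simp: linear_maps_def\<close>)
  then have "generated_submodule R M G \<subseteq> {x \<in> carrier M. h x = h' x}"
    using sub eq unfolding generated_submodule_def by blast
  then show ?thesis using gen x by auto
qed

lemma free_gen_generates: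
  assumes R: "cring R"
  shows "generated_submodule R (free_module R X) (free_gen R ` X) = carrier (free_module R X)"
proof -
  interpret cring R by fact
  let ?F = "free_module R X" and ?G = "generated_submodule R (free_module R X) (free_gen R ` X)"
  interpret F: module R ?F by (rule free_module_module[OF R])
  have sub: "free_gen R ` X \<subseteq> carrier ?F" using free_gen_carrier[OF R] by auto
  have sm: "submodule ?G R ?F" by (rule submodule_generated[OF F.module_axioms sub])
  have gG: "free_gen R x \<in> ?G" if "x \<in> X" for x using that by (auto simp: generated_submodule_def)
  have "p \<in> ?G" if "finite S" "p \<in> carrier ?F" "{x. p x \<noteq> \<zero>\<^bsub>R\<^esub>} \<subseteq> S" for S p
    using that
  proof (induction S arbitrary: p)
    case empty
    then have "p = \<zero>\<^bsub>?F\<^esub>" by (auto simp: free_module_def)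
    then show ?case using subgroup.one_closed[OF submodule.axioms(1)[OF sm]] by simp
  next
    case (insert x S)
    let ?q = "p(x := \<zero>\<^bsub>R\<^esub>)"
    have pc: "p y \<in> carrier R" for y using insert by (auto simp: free_module_def)
    have q: "?q \<in> carrier ?F" using insert.prems by (auto simp: free_module_def elim: finite_subset[rotated])
    have qG: "?q \<in> ?G" by (rule insert.IH[OF q]) (use insert.prems in auto)
    show ?case
    proof (cases "x \<in> X")
      case True
      have "p = ?q \<oplus>\<^bsub>?F\<^esub> (p x \<odot>\<^bsub>?F\<^esub> free_gen R x)"
        by (rule ext) (use pc in \<open>auto simp: free_module_def free_gen_def\<close>)
      also have "\<dots> \<in> ?G"
        using F.submoduleE(5)[OF sm qG F.submoduleE(4)[OF sm pc gG[OF True]]] .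
      finally show ?thesis .
    next
      case False
      then have "?q = p" using insert.prems by (auto simp: free_module_def)
      then show ?thesis using qG by simp
    qed
  qed
  then have "carrier ?F \<subseteq> ?G" by (auto simp: free_module_def)
  then show ?thesis using F.submoduleE(1)[OF sm] by auto
qed


lemma tensor_power_facts:
  fixes R :: "('r,'k) ring_scheme" and M :: "('r,'a,'m) module_scheme"
  assumes M: "module R M"
  shows "submodule (multilinear_relations R M n) R (tuple_module R M n)"
    and "module R (tensor_power R M n)"
proof -
  interpret M: module R M by fact
  interpret F: module R "tuple_module R M n" by (rule free_module_module) (rule M.R.is_cring)
  have g: "free_gen R xs \<in> carrier (tuple_module R M n)" if "set xs \<subseteq> carrier M" "length xs = n" for xs
    by (rule free_gen_carrier[OF M.R.is_cring]) (use that in \<open>simp add: tuples_def\<close>)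
  have g1: "free_gen R (xs @ (x \<oplus>\<^bsub>M\<^esub> y) # ys)
        \<ominus>\<^bsub>tuple_module R M n\<^esub> (free_gen R (xs @ x # ys) \<oplus>\<^bsub>tuple_module R M n\<^esub> free_gen R (xs @ y # ys)) \<in> carrier (tuple_module R M n)"
      if "x \<in> carrier M" "y \<in> carrier M" "set (xs @ ys) \<subseteq> carrier M" "length xs + 1 + length ys = n" for xs ys x y
    using that by (intro F.minus_closed F.add.m_closed g) auto
  have g2: "free_gen R (xs @ (r \<odot>\<^bsub>M\<^esub> x) # ys)
        \<ominus>\<^bsub>tuple_module R M n\<^esub> (r \<odot>\<^bsub>tuple_module R M n\<^esub> free_gen R (xs @ x # ys)) \<in> carrier (tuple_module R M n)"
      if "r \<in> carrier R" "x \<in> carrier M" "set (xs @ ys) \<subseteq> carrier M" "length xs + 1 + length ys = n" for xs ys x r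
    using that by (intro F.minus_closed F.smult_closed g) auto
  show 1: "submodule (multilinear_relations R M n) R (tuple_module R M n)"
    unfolding multilinear_relations_def
    by (rule submodule_generated[OF F.module_axioms]) (use g1 g2 in blast)
  show "module R (tensor_power R M n)"
    unfolding tensor_power_def by (rule quotient_module_module(1)[OF F.module_axioms 1])
qed

definition multilinear ::
    "('r, 'k) ring_scheme \<Rightarrow> ('r, 'a, 'm) module_scheme \<Rightarrow> ('r, 'b, 'n) module_scheme \<Rightarrow> nat
      \<Rightarrow> ('a list \<Rightarrow> 'b) \<Rightarrow> bool"
  where "multilinear R M N n f \<longleftrightarrow> f \<in> tuples M n \<rightarrow> carrier N \<and>
    (\<forall>xs ys. set (xs @ ys) \<subseteq> carrier M \<longrightarrow> length xs + 1 + length ys = n \<longrightarrow>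
       (\<lambda>x. f (xs @ x # ys)) \<in> linear_maps R M N)"

lemma pure_multilinear:
  fixes R :: "('r,'k) ring_scheme" and M :: "('r,'a,'m) module_scheme"
  assumes M: "module R M"
  shows "multilinear R M (tensor_power R M n) n (pure R M)"
proof -
  interpret M: module R M by fact
  let ?F = "tuple_module R M n" and ?K = "multilinear_relations R M n"
  interpret F: module R ?F by (rule free_module_module) (rule M.R.is_cring)
  note sub = tensor_power_facts(1)[OF M, of n]
  note Q = quotient_module_module(2-)[OF F.module_axioms sub, folded tensor_power_def]
  have g: "free_gen R xs \<in> carrier ?F" if "set xs \<subseteq> carrier M" "length xs = n" for xs
    by (rule free_gen_carrier[OF M.R.is_cring]) (use that in \<open>simp add: tuples_def\<close>)
  have as: "additive_subgroup ?K ?F" using sub by (simp add: additive_subgroup_def submodule_def)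
  interpret A: abelian_subgroup ?K ?F
    by (rule abelian_subgroupI3[OF as]) (rule F.abelian_group_axioms)
  have eqI: "?K +>\<^bsub>?F\<^esub> p = ?K +>\<^bsub>?F\<^esub> q" if "p \<ominus>\<^bsub>?F\<^esub> q \<in> ?K" "p \<in> carrier ?F" "q \<in> carrier ?F" for p q
  proof -
    have "p = (p \<ominus>\<^bsub>?F\<^esub> q) \<oplus>\<^bsub>?F\<^esub> q" using that(2,3)
      by (simp add: a_minus_def F.a_assoc F.l_neg)
    then have "p \<in> ?K +>\<^bsub>?F\<^esub> q" unfolding a_r_coset_def' using that(1) by blast
    then show ?thesis using A.a_repr_independence' that by metis
  qed
  show ?thesis
    unfolding multilinear_def linear_maps_def
  proof (intro conjI allI impI CollectI ballI)
    show "pure R M \<in> tuples M n \<rightarrow> carrier (tensor_power R M n)"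
    proof
      fix xs assume "xs \<in> tuples M n"
      then have "set xs \<subseteq> carrier M" "length xs = n" by (auto simp: tuples_def)
      then show "pure R M xs \<in> carrier (tensor_power R M n)" by (simp add: pure_def Q(3) imageI g)
    qed
  next
    fix xs ys assume l: "set (xs @ ys) \<subseteq> carrier M" "length xs + 1 + length ys = n"
    show "(\<lambda>x. pure R M (xs @ x # ys)) \<in> carrier M \<rightarrow> carrier (tensor_power R M n)"
      using l by (simp add: pure_def Q(3) imageI g)
    fix x assume x: "x \<in> carrier M"
    { fix y assume y: "y \<in> carrier M"
      have "free_gen R (xs @ (x \<oplus>\<^bsub>M\<^esub> y) # ys)
        \<ominus>\<^bsub>?F\<^esub> (free_gen R (xs @ x # ys) \<oplus>\<^bsub>?F\<^esub> free_gen R (xs @ y # ys)) \<in> ?K"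
        unfolding multilinear_relations_def
        by (rule subsetD[OF generated_submodule_incl], rule UnI1) (use l x y in blast)
      from eqI[OF this] show "pure R M (xs @ (x \<oplus>\<^bsub>M\<^esub> y) # ys) =
        pure R M (xs @ x # ys) \<oplus>\<^bsub>tensor_power R M n\<^esub> pure R M (xs @ y # ys)"
        using l x y by (auto simp: pure_def Q g) }
    fix r assume r: "r \<in> carrier R"
      have "free_gen R (xs @ (r \<odot>\<^bsub>M\<^esub> x) # ys)
        \<ominus>\<^bsub>?F\<^esub> (r \<odot>\<^bsub>?F\<^esub> free_gen R (xs @ x # ys)) \<in> ?K"
        unfolding multilinear_relations_def
        by (rule subsetD[OF generated_submodule_incl], rule UnI2) (use l x r in blast)
      from eqI[OF this] show "pure R M (xs @ (r \<odot>\<^bsub>M\<^esub> x) # ys) =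
        r \<odot>\<^bsub>tensor_power R M n\<^esub> pure R M (xs @ x # ys)"
        using l x r by (auto simp: pure_def Q g)
  qed
qed

lemma linear_kernel:
  assumes M: "module R M" and N: "module R N" and h: "h \<in> linear_maps R M N"
  shows "submodule {x \<in> carrier M. h x = \<zero>\<^bsub>N\<^esub>} R M"
    and "\<And>x. x \<in> carrier M \<Longrightarrow> h (\<ominus>\<^bsub>M\<^esub> x) = \<ominus>\<^bsub>N\<^esub> h x"
proof -
  interpret M: module R M by fact
  interpret N: module R N by fact
  have z: "h \<zero>\<^bsub>M\<^esub> = \<zero>\<^bsub>N\<^esub>"
    using h unfolding linear_maps_def
    by (smt (verit) M.M.zero_closed M.R.zero_closed M.smult_l_null N.smult_l_null PiE mem_Collect_eq)
  show neg: "h (\<ominus>\<^bsub>M\<^esub> x) = \<ominus>\<^bsub>N\<^esub> h x" if h': "x \<in> carrier M" for x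
  proof -
    have "h ((\<ominus>\<^bsub>R\<^esub> \<one>\<^bsub>R\<^esub>) \<odot>\<^bsub>M\<^esub> x) = (\<ominus>\<^bsub>R\<^esub> \<one>\<^bsub>R\<^esub>) \<odot>\<^bsub>N\<^esub> h x" "h x \<in> carrier N"
      using h h' unfolding linear_maps_def by auto
    then show ?thesis using h' by (simp add: M.smult_l_minus N.smult_l_minus)
  qed
  show "submodule {x \<in> carrier M. h x = \<zero>\<^bsub>N\<^esub>} R M"
    by (rule M.submoduleI) (use h z neg in \<open>auto simp: linear_maps_def\<close>)
qed

theorem tensor_lift_unique:
  fixes R :: "('r,'k) ring_scheme" and M :: "('r,'a,'m) module_scheme" and N :: "('r,'b,'n) module_scheme"
  assumes M: "module R M" and N: "module R N" and f: "multilinear R M N n f"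
  shows "\<exists>!h. h \<in> linear_maps R (tensor_power R M n) N \<and>
            h \<in> extensional (carrier (tensor_power R M n)) \<and>
            (\<forall>xs\<in>tuples M n. h (pure R M xs) = f xs)"
proof -
  interpret M: module R M by fact
  interpret N: module R N by fact
  let ?F = "tuple_module R M n" and ?K = "multilinear_relations R M n" and ?T = "tensor_power R M n"
  interpret F: module R ?F by (rule free_module_module) (rule M.R.is_cring)
  interpret T: module R ?T by (rule tensor_power_facts(2)[OF M])
  note sub = tensor_power_facts(1)[OF M, of n]
  note Q = quotient_module_module(2-)[OF F.module_axioms sub, folded tensor_power_def]
  have as: "additive_subgroup ?K ?F" using sub by (simp add: additive_subgroup_def submodule_def)
  interpret A: abelian_subgroup ?K ?F
    by (rule abelian_subgroupI3[OF as]) (rule F.abelian_group_axioms)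
  have fc: "f \<in> tuples M n \<rightarrow> carrier N" using f by (simp add: multilinear_def)
  obtain H where H: "H \<in> linear_maps R ?F N" and Hg: "\<And>xs. xs \<in> tuples M n \<Longrightarrow> H (free_gen R xs) = f xs"
    using free_extend[OF N fc] by blast
  note Hl = H[unfolded linear_maps_def, simplified]
  have g: "free_gen R xs \<in> carrier ?F" if "set xs \<subseteq> carrier M" "length xs = n" for xs
    by (rule free_gen_carrier[OF M.R.is_cring]) (use that in \<open>simp add: tuples_def\<close>)
  have Hc: "H p \<in> carrier N" if "p \<in> carrier ?F" for p using Hl that by auto
  have Hm: "H (p \<ominus>\<^bsub>?F\<^esub> q) = H p \<ominus>\<^bsub>N\<^esub> H q" if "p \<in> carrier ?F" "q \<in> carrier ?F" for p q
    using that Hl linear_kernel(2)[OF F.module_axioms N H] by (simp add: a_minus_def)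
  have g1: "free_gen R (xs @ (x \<oplus>\<^bsub>M\<^esub> y) # ys)
        \<ominus>\<^bsub>?F\<^esub> (free_gen R (xs @ x # ys) \<oplus>\<^bsub>?F\<^esub> free_gen R (xs @ y # ys)) \<in> carrier ?F"
      if "x \<in> carrier M" "y \<in> carrier M" "set (xs @ ys) \<subseteq> carrier M" "length xs + 1 + length ys = n" for xs ys x y
    using that by (intro F.minus_closed F.add.m_closed g) auto
  have g2: "free_gen R (xs @ (r \<odot>\<^bsub>M\<^esub> x) # ys)
        \<ominus>\<^bsub>?F\<^esub> (r \<odot>\<^bsub>?F\<^esub> free_gen R (xs @ x # ys)) \<in> carrier ?F"
      if "r \<in> carrier R" "x \<in> carrier M" "set (xs @ ys) \<subseteq> carrier M" "length xs + 1 + length ys = n" for xs ys x r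
    using that by (intro F.minus_closed F.smult_closed g) auto
  have KH: "?K \<subseteq> {p \<in> carrier ?F. H p = \<zero>\<^bsub>N\<^esub>}"
  proof -
    have k1: "H (free_gen R (xs @ (x \<oplus>\<^bsub>M\<^esub> y) # ys)
        \<ominus>\<^bsub>?F\<^esub> (free_gen R (xs @ x # ys) \<oplus>\<^bsub>?F\<^esub> free_gen R (xs @ y # ys))) = \<zero>\<^bsub>N\<^esub>"
      if l: "set (xs @ ys) \<subseteq> carrier M" "length xs + 1 + length ys = n" "x \<in> carrier M" "y \<in> carrier M" for xs ys x y
    proof -
      have t: "xs @ x # ys \<in> tuples M n" "xs @ y # ys \<in> tuples M n" "xs @ (x \<oplus>\<^bsub>M\<^esub> y) # ys \<in> tuples M n"
        using l by (auto simp: tuples_def)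
      have "f (xs @ (x \<oplus>\<^bsub>M\<^esub> y) # ys) = f (xs @ x # ys) \<oplus>\<^bsub>N\<^esub> f (xs @ y # ys)"
        using f l unfolding multilinear_def linear_maps_def by blast
      moreover have "f (xs @ x # ys) \<in> carrier N" "f (xs @ y # ys) \<in> carrier N" using fc t by auto
      moreover note g' = free_gen_carrier[OF M.R.is_cring t(1)] free_gen_carrier[OF M.R.is_cring t(2)] free_gen_carrier[OF M.R.is_cring t(3)]
      ultimately show ?thesis
        using Hl by (simp add: Hm Hg t N.r_neg a_minus_def[of N])
    qed
    have k2: "H (free_gen R (xs @ (r \<odot>\<^bsub>M\<^esub> x) # ys)
        \<ominus>\<^bsub>?F\<^esub> (r \<odot>\<^bsub>?F\<^esub> free_gen R (xs @ x # ys))) = \<zero>\<^bsub>N\<^esub>"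
      if l: "set (xs @ ys) \<subseteq> carrier M" "length xs + 1 + length ys = n" "x \<in> carrier M" "r \<in> carrier R" for xs ys x r
    proof -
      have t: "xs @ x # ys \<in> tuples M n" "xs @ (r \<odot>\<^bsub>M\<^esub> x) # ys \<in> tuples M n"
        using l by (auto simp: tuples_def)
      have "f (xs @ (r \<odot>\<^bsub>M\<^esub> x) # ys) = r \<odot>\<^bsub>N\<^esub> f (xs @ x # ys)"
        using f l unfolding multilinear_def linear_maps_def by blast
      moreover have "f (xs @ x # ys) \<in> carrier N" using fc t by auto
      moreover note g' = free_gen_carrier[OF M.R.is_cring t(1)] free_gen_carrier[OF M.R.is_cring t(2)]
      ultimately show ?thesis
        using Hl l by (simp add: Hm Hg t N.r_neg a_minus_def[of N])
    qed
    show ?thesis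
      unfolding multilinear_relations_def generated_submodule_def
      by (intro Inter_lower CollectI conjI linear_kernel(1)[OF F.module_axioms N H] subsetI)
        (elim UnE CollectE exE conjE; simp add: g1 g2 k1 k2)+
  qed
  define h where "h = (\<lambda>A\<in>carrier ?T. H (SOME p. p \<in> A))"
  have hH: "h (?K +>\<^bsub>?F\<^esub> p) = H p" if p: "p \<in> carrier ?F" for p
  proof -
    let ?q = "SOME q. q \<in> ?K +>\<^bsub>?F\<^esub> p"
    have "?q \<in> ?K +>\<^bsub>?F\<^esub> p" using A.a_rcos_self[OF p] by (metis someI)
    then obtain k where k: "k \<in> ?K" "?q = k \<oplus>\<^bsub>?F\<^esub> p" by (auto simp: a_r_coset_def')
    then have "H ?q = \<zero>\<^bsub>N\<^esub> \<oplus>\<^bsub>N\<^esub> H p" using KH Hl p by auto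
    then show ?thesis using p Hc by (simp add: h_def Q)
  qed
  have pc: "pure R M xs \<in> carrier ?T" if "xs \<in> tuples M n" for xs
    using pure_multilinear[OF M, of n] that by (auto simp: multilinear_def)
  have hlin: "h \<in> linear_maps R ?T N"
    using Hl by (auto simp: linear_maps_def Q hH)
  have hp: "h (pure R M xs) = f xs" if "xs \<in> tuples M n" for xs
    using that hH[OF free_gen_carrier[OF M.R.is_cring that]] Hg[OF that] by (simp add: pure_def tuples_def)
  show ?thesis
  proof (rule ex1I[of _ h])
    show "h \<in> linear_maps R ?T N \<and> h \<in> extensional (carrier ?T) \<and> (\<forall>xs\<in>tuples M n. h (pure R M xs) = f xs)"
      using hlin hp by (auto simp: h_def)
    fix h' assume h': "h' \<in> linear_maps R ?T N \<and> h' \<in> extensional (carrier ?T) \<and> (\<forall>xs\<in>tuples M n. h' (pure R M xs) = f xs)"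
    show "h' = h"
    proof (rule extensionalityI[of _ "carrier ?T"])
      fix t assume "t \<in> carrier ?T"
      then obtain p where p: "p \<in> carrier ?F" "t = ?K +>\<^bsub>?F\<^esub> p" by (auto simp: Q)
      have 1: "(\<lambda>p. h' (?K +>\<^bsub>?F\<^esub> p)) \<in> linear_maps R ?F N"
        using h' by (auto simp: linear_maps_def Q simp flip: Q(1,2))
      have 2: "h' (?K +>\<^bsub>?F\<^esub> q) = H q" if "q \<in> free_gen R ` tuples M n" for q
        using that h' Hg by (auto simp: pure_def tuples_def)
      show "h' t = h t"
        unfolding p(2) hH[OF p(1)]
        by (rule linear_ext[OF F.module_axioms N 1 H _ free_gen_generates[OF M.R.is_cring] 2 p(1)])
          (use free_gen_carrier[OF M.R.is_cring] in auto)
    qed (use h' in \<open>auto simp: h_def\<close>)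
  qed
qed

lemma tensor_lift:
  assumes "module R M" "module R N" "multilinear R M N n f"
  shows "tensor_lift R M N n f \<in> linear_maps R (tensor_power R M n) N"
    and "\<And>xs. xs \<in> tuples M n \<Longrightarrow> tensor_lift R M N n f (pure R M xs) = f xs"
  using theI'[OF tensor_lift_unique[OF assms]] unfolding tensor_lift_def by blast+

lemma multilinear_1:
  assumes "f \<in> linear_maps R M N"
  shows "multilinear R M N 1 (\<lambda>xs. f (hd xs))"
  using assms by (auto simp: multilinear_def linear_maps_def tuples_def length_Suc_conv)

text \<open>\<open>f \<otimes> g : M\<^sup>\<otimes>\<^sup>(\<^sup>l\<^sup>+\<^sup>l\<^sup>'\<^sup>) \<rightarrow> M\<^sup>\<otimes>\<^sup>(\<^sup>r\<^sup>+\<^sup>r\<^sup>'\<^sup>)\<close> for \<open>f : M\<^sup>\<otimes>\<^sup>l \<rightarrow> M\<^sup>\<otimes>\<^sup>r\<close>, \<open>g : M\<^sup>\<otimes>\<^sup>l\<^sup>' \<rightarrow> M\<^sup>\<otimes>\<^sup>r\<^sup>'\<close>.\<close>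

definition tensor_map ::
    "('r, 'k) ring_scheme \<Rightarrow> ('r, 'a, 'm) module_scheme \<Rightarrow> nat \<Rightarrow> nat \<Rightarrow> nat \<Rightarrow> nat
      \<Rightarrow> (('a list \<Rightarrow> 'r) set \<Rightarrow> ('a list \<Rightarrow> 'r) set) \<Rightarrow> (('a list \<Rightarrow> 'r) set \<Rightarrow> ('a list \<Rightarrow> 'r) set)
      \<Rightarrow> ('a list \<Rightarrow> 'r) set \<Rightarrow> ('a list \<Rightarrow> 'r) set"
  where "tensor_map R M l r l' r' f g =
    tensor_lift R M (tensor_power R M (r + r')) (l + l')
      (\<lambda>xs. tensor_mult R M r r' (f (pure R M (take l xs))) (g (pure R M (drop l xs))))"

text \<open>
  \<open>\<phi>\<^sub>i = Id\<^sup>\<otimes>\<^sup>(\<^sup>i\<^sup>-\<^sup>1\<^sup>) \<otimes> \<phi> \<otimes> Id\<^sup>\<otimes>\<^sup>(\<^sup>k\<^sup>-\<^sup>i\<^sup>+\<^sup>1\<^sup>) : M\<^sup>\<otimes>\<^sup>(\<^sup>k\<^sup>+\<^sup>l\<^sup>) \<rightarrow> M\<^sup>\<otimes>\<^sup>(\<^sup>k\<^sup>+\<^sup>r\<^sup>)\<close>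
  for \<open>\<phi> : M\<^sup>\<otimes>\<^sup>l \<rightarrow> M\<^sup>\<otimes>\<^sup>r\<close> and \<open>1 \<le> i \<le> k + 1\<close>.
\<close>

definition at_pos ::
    "('r, 'k) ring_scheme \<Rightarrow> ('r, 'a, 'm) module_scheme \<Rightarrow> nat \<Rightarrow> nat \<Rightarrow> nat \<Rightarrow> nat
      \<Rightarrow> (('a list \<Rightarrow> 'r) set \<Rightarrow> ('a list \<Rightarrow> 'r) set) \<Rightarrow> ('a list \<Rightarrow> 'r) set \<Rightarrow> ('a list \<Rightarrow> 'r) set"
  where "at_pos R M l r k i \<phi> =
    tensor_map R M (i - 1) (i - 1) (l + (k + 1 - i)) (r + (k + 1 - i)) (\<lambda>t. t)
      (tensor_map R M l r (k + 1 - i) (k + 1 - i) \<phi> (\<lambda>t. t))"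

text \<open>
  \<open>\<phi>\<^sup>n = \<phi>\<^sub>1 \<circ> \<dots> \<circ> \<phi>\<^sub>1\<close> with domain \<open>M\<^sup>\<otimes>\<^sup>d\<close>; the number of identity factors in \<open>\<phi>\<^sub>1\<close> changes
  from one factor of the composite to the next.
\<close>

fun power_map ::
    "('r, 'k) ring_scheme \<Rightarrow> ('r, 'a, 'm) module_scheme \<Rightarrow> nat \<Rightarrow> nat \<Rightarrow> nat \<Rightarrow> nat
      \<Rightarrow> (('a list \<Rightarrow> 'r) set \<Rightarrow> ('a list \<Rightarrow> 'r) set) \<Rightarrow> ('a list \<Rightarrow> 'r) set \<Rightarrow> ('a list \<Rightarrow> 'r) set"
  where
    "power_map R M l r d 0 \<phi> = (\<lambda>t. t)"
  | "power_map R M l r d (Suc n) \<phi> =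
       power_map R M l r (d - l + r) n \<phi> \<circ> at_pos R M l r (d - l) 1 \<phi>"

definition flip_map ::
    "('r, 'k) ring_scheme \<Rightarrow> ('r, 'a, 'm) module_scheme \<Rightarrow> ('a list \<Rightarrow> 'r) set \<Rightarrow> ('a list \<Rightarrow> 'r) set"
  where "flip_map R M =
    tensor_lift R M (tensor_power R M 2) 2 (\<lambda>xs. pure R M [xs ! 1, xs ! 0])"

text \<open>Equality of two maps with domain \<open>M\<^sup>\<otimes>\<^sup>n\<close>.\<close>

definition eq_on_power ::
    "('r, 'k) ring_scheme \<Rightarrow> ('r, 'a, 'm) module_scheme \<Rightarrow> nat
      \<Rightarrow> (('a list \<Rightarrow> 'r) set \<Rightarrow> 'b) \<Rightarrow> (('a list \<Rightarrow> 'r) set \<Rightarrow> 'b) \<Rightarrow> bool"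
  where "eq_on_power R M n f g \<longleftrightarrow> (\<forall>t\<in>carrier (tensor_power R M n). f t = g t)"


section \<open>Shelves and racks in the category of modules\<close>

text \<open>
  A comultiplication \<open>D : M \<rightarrow> M \<otimes> M\<close>, a counit \<open>e : M \<rightarrow> R\<close> and operations
  \<open>s, s' : M \<otimes> M \<rightarrow> M\<close>. In \<open>at_pos R M l r k i \<phi>\<close> the map \<open>\<phi>\<close> goes from \<open>l\<close> to \<open>r\<close> factors
  and \<open>k\<close> is the number of identity factors.
\<close>

definition shelf_comultiplication where
  "shelf_comultiplication R M D \<longleftrightarrow>
    D \<in> linear_maps R (tensor_power R M 1) (tensor_power R M 2) \<and>
    eq_on_power R M 1 (at_pos R M 1 2 1 1 D \<circ> D) (at_pos R M 1 2 1 2 D \<circ> D) \<and>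
    eq_on_power R M 1 (at_pos R M 2 2 2 2 (flip_map R M) \<circ> power_map R M 1 2 1 3 D)
      (power_map R M 1 2 1 3 D)"

definition generalized_self_distributive where
  "generalized_self_distributive R M D s \<longleftrightarrow>
    eq_on_power R M 3 (power_map R M 2 1 3 2 s)
      (s \<circ> tensor_map R M 2 1 2 1 s s \<circ> at_pos R M 2 2 2 2 (flip_map R M) \<circ> at_pos R M 1 2 2 3 D)"

definition shelf_compatibility where
  "shelf_compatibility R M D s \<longleftrightarrow>
    eq_on_power R M 2 (D \<circ> s)
      (tensor_map R M 2 1 2 1 s s \<circ> at_pos R M 2 2 2 2 (flip_map R M) \<circ> tensor_map R M 1 2 1 2 D D)"

definition rack_counit where
  "rack_counit R M D e \<longleftrightarrow>
    e \<in> linear_maps R (tensor_power R M 1) (tensor_power R M 0) \<and>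
    eq_on_power R M 1 (at_pos R M 1 0 1 2 e \<circ> D) (\<lambda>t. t)"

definition rack_inverse where
  "rack_inverse R M D e s s' \<longleftrightarrow>
    s' \<in> linear_maps R (tensor_power R M 2) (tensor_power R M 1) \<and>
    eq_on_power R M 2
      (s' \<circ> at_pos R M 2 1 1 1 s \<circ> at_pos R M 2 2 1 2 (flip_map R M) \<circ> at_pos R M 1 2 1 2 D)
      (tensor_map R M 1 1 1 0 (\<lambda>t. t) e) \<and>
    eq_on_power R M 2
      (s \<circ> at_pos R M 2 1 1 1 s' \<circ> at_pos R M 2 2 1 2 (flip_map R M) \<circ> at_pos R M 1 2 1 2 D)
      (tensor_map R M 1 1 1 0 (\<lambda>t. t) e)"

definition shelf where
  "shelf R M D s \<longleftrightarrow>
    module R M \<and>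
    s \<in> linear_maps R (tensor_power R M 2) (tensor_power R M 1) \<and>
    shelf_comultiplication R M D \<and>
    generalized_self_distributive R M D s \<and>
    shelf_compatibility R M D s"

definition rack where
  "rack R M D e s s' \<longleftrightarrow> shelf R M D s \<and> rack_counit R M D e \<and> rack_inverse R M D e s s'"

definition rack_except_GSD where
  "rack_except_GSD R M D e s s' \<longleftrightarrow>
    module R M \<and>
    s \<in> linear_maps R (tensor_power R M 2) (tensor_power R M 1) \<and>
    shelf_comultiplication R M D \<and>
    shelf_compatibility R M D s \<and>
    rack_counit R M D e \<and>
    rack_inverse R M D e s s'"

lemma rack_iff_GSD:
  "rack R M D e s s' \<longleftrightarrow> rack_except_GSD R M D e s s' \<and> generalized_self_distributive R M D s"
  by (auto simp: rack_def shelf_def rack_except_GSD_def)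

text \<open>The map \<open>\<sigma> = s\<^sub>2 \<circ> c\<^sub>1 \<circ> D\<^sub>2 : M \<otimes> M \<rightarrow> M \<otimes> M\<close>.\<close>

definition rack_braiding where
  "rack_braiding R M D s =
    at_pos R M 2 1 1 2 s \<circ> at_pos R M 2 2 1 1 (flip_map R M) \<circ> at_pos R M 1 2 1 2 D"


section \<open>The structure on \<open>V \<oplus> R\<one>\<close>\<close>

definition unit_ext ::
    "('r, 'k) ring_scheme \<Rightarrow> ('r, 'v, 'm) module_scheme \<Rightarrow> ('r, 'v \<times> 'r) module"
  where "unit_ext R V =
    \<lparr>carrier = carrier V \<times> carrier R, mult = undefined, one = undefined,
     zero = (\<zero>\<^bsub>V\<^esub>, \<zero>\<^bsub>R\<^esub>),
     add = (\<lambda>(v, a) (w, b). (v \<oplus>\<^bsub>V\<^esub> w, a \<oplus>\<^bsub>R\<^esub> b)),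
     smult = (\<lambda>r (v, a). (r \<odot>\<^bsub>V\<^esub> v, r \<otimes>\<^bsub>R\<^esub> a))\<rparr>"

definition unit_elt :: "('r, 'k) ring_scheme \<Rightarrow> ('r, 'v, 'm) module_scheme \<Rightarrow> 'v \<times> 'r"
  where "unit_elt R V = (\<zero>\<^bsub>V\<^esub>, \<one>\<^bsub>R\<^esub>)"

text \<open>In the following, the pair \<open>(v, a)\<close> is \<open>v + a\<one>\<close>.\<close>

definition lei_comult ::
    "('r, 'k) ring_scheme \<Rightarrow> ('r, 'v, 'm) module_scheme
      \<Rightarrow> (('v \<times> 'r) list \<Rightarrow> 'r) set \<Rightarrow> (('v \<times> 'r) list \<Rightarrow> 'r) set"
  where "lei_comult R V =
    (let E = unit_ext R V; T = tensor_power R E 2; u = unit_elt R V in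
      tensor_lift R E T 1 (\<lambda>xs. case hd xs of (v, a) \<Rightarrow>
        (pure R E [(v, \<zero>\<^bsub>R\<^esub>), u] \<oplus>\<^bsub>T\<^esub> pure R E [u, (v, \<zero>\<^bsub>R\<^esub>)]) \<oplus>\<^bsub>T\<^esub> a \<odot>\<^bsub>T\<^esub> pure R E [u, u]))"

definition lei_counit ::
    "('r, 'k) ring_scheme \<Rightarrow> ('r, 'v, 'm) module_scheme
      \<Rightarrow> (('v \<times> 'r) list \<Rightarrow> 'r) set \<Rightarrow> (('v \<times> 'r) list \<Rightarrow> 'r) set"
  where "lei_counit R V =
    (let E = unit_ext R V; T = tensor_power R E 0 in
      tensor_lift R E T 1 (\<lambda>xs. case hd xs of (v, a) \<Rightarrow> a \<odot>\<^bsub>T\<^esub> pure R E []))"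

text \<open>
  Bilinear extension: \<open>(v + a\<one>) \<lhd> (w + b\<one>) = [v, w] + b v + a b \<one>\<close>, because
  \<open>\<one> \<lhd> w = 0\<close> and \<open>\<one> \<lhd> \<one> = \<one>\<close>.
\<close>

definition lei_op ::
    "('r, 'k) ring_scheme \<Rightarrow> ('r, 'v, 'm) module_scheme \<Rightarrow> ('v \<Rightarrow> 'v \<Rightarrow> 'v)
      \<Rightarrow> 'v \<times> 'r \<Rightarrow> 'v \<times> 'r \<Rightarrow> 'v \<times> 'r"
  where "lei_op R V br = (\<lambda>(v, a) (w, b). (br v w \<oplus>\<^bsub>V\<^esub> b \<odot>\<^bsub>V\<^esub> v, a \<otimes>\<^bsub>R\<^esub> b))"

definition lei_op_tilde ::
    "('r, 'k) ring_scheme \<Rightarrow> ('r, 'v, 'm) module_scheme \<Rightarrow> ('v \<Rightarrow> 'v \<Rightarrow> 'v)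
      \<Rightarrow> 'v \<times> 'r \<Rightarrow> 'v \<times> 'r \<Rightarrow> 'v \<times> 'r"
  where "lei_op_tilde R V br = (\<lambda>(v, a) (w, b). (\<ominus>\<^bsub>V\<^esub> br v w \<oplus>\<^bsub>V\<^esub> b \<odot>\<^bsub>V\<^esub> v, a \<otimes>\<^bsub>R\<^esub> b))"

definition op_map ::
    "('r, 'k) ring_scheme \<Rightarrow> ('r, 'a, 'm) module_scheme \<Rightarrow> ('a \<Rightarrow> 'a \<Rightarrow> 'a)
      \<Rightarrow> ('a list \<Rightarrow> 'r) set \<Rightarrow> ('a list \<Rightarrow> 'r) set"
  where "op_map R M f =
    tensor_lift R M (tensor_power R M 1) 2 (\<lambda>xs. pure R M [f (xs ! 0) (xs ! 1)])"

text \<open>The bracket extended by \<open>[\<one>, x] = [x, \<one>] = 0\<close>.\<close>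

definition bracket_ext ::
    "('r, 'k) ring_scheme \<Rightarrow> ('v \<Rightarrow> 'v \<Rightarrow> 'v) \<Rightarrow> 'v \<times> 'r \<Rightarrow> 'v \<times> 'r \<Rightarrow> 'v \<times> 'r"
  where "bracket_ext R br = (\<lambda>(v, a) (w, b). (br v w, \<zero>\<^bsub>R\<^esub>))"

definition bracket_braiding ::
    "('r, 'k) ring_scheme \<Rightarrow> ('r, 'v, 'm) module_scheme \<Rightarrow> ('v \<Rightarrow> 'v \<Rightarrow> 'v)
      \<Rightarrow> (('v \<times> 'r) list \<Rightarrow> 'r) set \<Rightarrow> (('v \<times> 'r) list \<Rightarrow> 'r) set"
  where "bracket_braiding R V br =
    (let E = unit_ext R V; T = tensor_power R E 2 in
      tensor_lift R E T 2 (\<lambda>xs. let a = xs ! 0; b = xs ! 1 in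
        pure R E [b, a] \<oplus>\<^bsub>T\<^esub> pure R E [unit_elt R V, bracket_ext R br a b]))"

definition leibniz :: "('r, 'v, 'm) module_scheme \<Rightarrow> ('v \<Rightarrow> 'v \<Rightarrow> 'v) \<Rightarrow> bool"
  where "leibniz V br \<longleftrightarrow>
    (\<forall>v\<in>carrier V. \<forall>w\<in>carrier V. \<forall>u\<in>carrier V.
      br v (br w u) = br (br v w) u \<ominus>\<^bsub>V\<^esub> br (br v u) w)"


text \<open>The defining equations of the structure maps on \<open>V \<oplus> R\<one>\<close>.\<close>

lemma unit_ext_module:
  assumes "module R V" shows "module R (unit_ext R V)"
proof -
  interpret module R V by fact
  have "abelian_group (unit_ext R V)"
  proof (rule abelian_groupI)
    fix p assume "p \<in> carrier (unit_ext R V)"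
    then show "\<exists>y\<in>carrier (unit_ext R V). y \<oplus>\<^bsub>unit_ext R V\<^esub> p = \<zero>\<^bsub>unit_ext R V\<^esub>"
      by (intro bexI[of _ "(\<ominus>\<^bsub>V\<^esub> fst p, \<ominus>\<^bsub>R\<^esub> snd p)"]) (auto simp: unit_ext_def M.l_neg R.l_neg)
  qed (auto simp: unit_ext_def M.a_ac R.a_ac)
  then show ?thesis
    by (rule moduleI[OF R.is_cring])
      (auto simp: unit_ext_def smult_l_distr smult_r_distr smult_assoc1 R.l_distr R.r_distr R.m_assoc)
qed

lemma lei_comult_values:
  assumes V: "module R V"
  defines "E \<equiv> unit_ext R V" and "T \<equiv> tensor_power R (unit_ext R V) 2" and "u \<equiv> unit_elt R V"
  shows "lei_comult R V \<in> linear_maps R (tensor_power R E 1) T"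
    and "\<And>v. v \<in> carrier V \<Longrightarrow> lei_comult R V (pure R E [(v, \<zero>\<^bsub>R\<^esub>)]) =
      pure R E [(v, \<zero>\<^bsub>R\<^esub>), u] \<oplus>\<^bsub>T\<^esub> pure R E [u, (v, \<zero>\<^bsub>R\<^esub>)]"
    and "lei_comult R V (pure R E [u]) = pure R E [u, u]"
proof -
  interpret V: module R V by fact
  have E: "module R E" unfolding E_def by (rule unit_ext_module[OF V])
  interpret T: module R T unfolding T_def by (rule tensor_power_facts(2)[OF E[unfolded E_def]])
  note pm = pure_multilinear[OF E, of 2, folded T_def[folded E_def]]
  have uE: "u \<in> carrier E" by (simp add: u_def E_def unit_ext_def unit_elt_def)
  have vE: "(v, \<zero>\<^bsub>R\<^esub>) \<in> carrier E" if "v \<in> carrier V" for v using that by (simp add: E_def unit_ext_def)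
  have l1: "(\<lambda>x. pure R E [x, u]) \<in> linear_maps R E T" and l2: "(\<lambda>x. pure R E [u, x]) \<in> linear_maps R E T"
    using pm uE unfolding multilinear_def
    by (auto dest!: conjunct2 dest: spec2[of _ "[]" "[u]"] spec2[of _ "[u]" "[]"])
  have pc: "pure R E [x, y] \<in> carrier T" if "x \<in> carrier E" "y \<in> carrier E" for x y
    using pm that by (auto simp: multilinear_def tuples_def)
  let ?f = "\<lambda>(v, a). (pure R E [(v, \<zero>\<^bsub>R\<^esub>), u] \<oplus>\<^bsub>T\<^esub> pure R E [u, (v, \<zero>\<^bsub>R\<^esub>)]) \<oplus>\<^bsub>T\<^esub> a \<odot>\<^bsub>T\<^esub> pure R E [u, u]"
  have e: "(v \<oplus>\<^bsub>V\<^esub> w, \<zero>\<^bsub>R\<^esub>) = (v, \<zero>\<^bsub>R\<^esub>) \<oplus>\<^bsub>E\<^esub> (w, \<zero>\<^bsub>R\<^esub>)" "(r \<odot>\<^bsub>V\<^esub> v, \<zero>\<^bsub>R\<^esub>) = r \<odot>\<^bsub>E\<^esub> (v, \<zero>\<^bsub>R\<^esub>)"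
    if "v \<in> carrier V" "w \<in> carrier V" "r \<in> carrier R" for v w r
    using that by (auto simp: E_def unit_ext_def)
  have lf: "?f \<in> linear_maps R E T"
    unfolding linear_maps_def
  proof (intro CollectI conjI ballI)
    show "?f \<in> carrier E \<rightarrow> carrier T"
      using pc uE vE by (auto simp: E_def unit_ext_def)
  next
    fix x y assume xy: "x \<in> carrier E" "y \<in> carrier E"
    obtain v a w b where [simp]: "x = (v, a)" "y = (w, b)" by (cases x, cases y)
    have c: "v \<in> carrier V" "w \<in> carrier V" "a \<in> carrier R" "b \<in> carrier R"
      using xy by (auto simp: E_def unit_ext_def)
    have "x \<oplus>\<^bsub>E\<^esub> y = (v \<oplus>\<^bsub>V\<^esub> w, a \<oplus>\<^bsub>R\<^esub> b)" by (simp add: E_def unit_ext_def)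
    moreover have "pure R E [(v \<oplus>\<^bsub>V\<^esub> w, \<zero>\<^bsub>R\<^esub>), u] = pure R E [(v, \<zero>\<^bsub>R\<^esub>), u] \<oplus>\<^bsub>T\<^esub> pure R E [(w, \<zero>\<^bsub>R\<^esub>), u]"
      "pure R E [u, (v \<oplus>\<^bsub>V\<^esub> w, \<zero>\<^bsub>R\<^esub>)] = pure R E [u, (v, \<zero>\<^bsub>R\<^esub>)] \<oplus>\<^bsub>T\<^esub> pure R E [u, (w, \<zero>\<^bsub>R\<^esub>)]"
      using l1 l2 vE[OF c(1)] vE[OF c(2)] unfolding e(1)[OF c(1,2,3)] linear_maps_def by blast+
    ultimately show "?f (x \<oplus>\<^bsub>E\<^esub> y) = ?f x \<oplus>\<^bsub>T\<^esub> ?f y"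
      using c vE uE pc by (simp add: T.smult_l_distr T.M.a_ac)
  next
    fix r x assume xy: "r \<in> carrier R" "x \<in> carrier E"
    obtain v a where [simp]: "x = (v, a)" by (cases x)
    have c: "v \<in> carrier V" "a \<in> carrier R" "r \<in> carrier R"
      using xy by (auto simp: E_def unit_ext_def)
    have "r \<odot>\<^bsub>E\<^esub> x = (r \<odot>\<^bsub>V\<^esub> v, r \<otimes>\<^bsub>R\<^esub> a)" by (simp add: E_def unit_ext_def)
    moreover have "pure R E [(r \<odot>\<^bsub>V\<^esub> v, \<zero>\<^bsub>R\<^esub>), u] = r \<odot>\<^bsub>T\<^esub> pure R E [(v, \<zero>\<^bsub>R\<^esub>), u]"
      "pure R E [u, (r \<odot>\<^bsub>V\<^esub> v, \<zero>\<^bsub>R\<^esub>)] = r \<odot>\<^bsub>T\<^esub> pure R E [u, (v, \<zero>\<^bsub>R\<^esub>)]"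
      using l1 l2 vE[OF c(1)] c(3) unfolding e(2)[OF c(1,1,3)] linear_maps_def by blast+
    ultimately show "?f (r \<odot>\<^bsub>E\<^esub> x) = r \<odot>\<^bsub>T\<^esub> ?f x"
      using c vE uE pc by (simp add: T.smult_r_distr T.smult_assoc1)
  qed
  have d: "lei_comult R V = tensor_lift R E T 1 (\<lambda>xs. ?f (hd xs))"
    unfolding lei_comult_def Let_def E_def T_def u_def by simp
  note L = tensor_lift[OF E T.module_axioms multilinear_1[OF lf], folded d]
  show "lei_comult R V \<in> linear_maps R (tensor_power R E 1) T" by (rule L(1))
  show "lei_comult R V (pure R E [(v, \<zero>\<^bsub>R\<^esub>)]) =
      pure R E [(v, \<zero>\<^bsub>R\<^esub>), u] \<oplus>\<^bsub>T\<^esub> pure R E [u, (v, \<zero>\<^bsub>R\<^esub>)]" if "v \<in> carrier V" for v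
    using that vE uE pc by (subst L(2)) (auto simp: tuples_def)
  have "(\<zero>\<^bsub>V\<^esub>, \<zero>\<^bsub>R\<^esub>) = \<zero>\<^bsub>E\<^esub>" by (simp add: E_def unit_ext_def)
  moreover have "h \<zero>\<^bsub>E\<^esub> = \<zero>\<^bsub>T\<^esub>" if "h \<in> linear_maps R E T" for h
  proof -
    interpret E: module R E by (rule E)
    have "h (\<zero>\<^bsub>R\<^esub> \<odot>\<^bsub>E\<^esub> \<zero>\<^bsub>E\<^esub>) = \<zero>\<^bsub>R\<^esub> \<odot>\<^bsub>T\<^esub> h \<zero>\<^bsub>E\<^esub>" "h \<zero>\<^bsub>E\<^esub> \<in> carrier T"
      using that E.M.zero_closed V.R.zero_closed unfolding linear_maps_def by blast+
    then show ?thesis by simp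
  qed
  note this[OF l1] this[OF l2]
  ultimately show "lei_comult R V (pure R E [u]) = pure R E [u, u]"
    using uE pc by (subst L(2)) (auto simp: tuples_def u_def unit_elt_def)
qed

lemma lei_counit_values:
  assumes V: "module R V"
  defines "E \<equiv> unit_ext R V" and "T \<equiv> tensor_power R (unit_ext R V) 0" and "u \<equiv> unit_elt R V"
  shows "lei_counit R V \<in> linear_maps R (tensor_power R E 1) T"
    and "\<And>v. v \<in> carrier V \<Longrightarrow> lei_counit R V (pure R E [(v, \<zero>\<^bsub>R\<^esub>)]) = \<zero>\<^bsub>T\<^esub>"
    and "lei_counit R V (pure R E [u]) = pure R E []"
proof -
  interpret V: module R V by fact
  have E: "module R E" unfolding E_def by (rule unit_ext_module[OF V])
  interpret T: module R T unfolding T_def by (rule tensor_power_facts(2)[OF E[unfolded E_def]])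
  have pc: "pure R E [] \<in> carrier T"
    using pure_multilinear[OF E, of 0, folded T_def[folded E_def]] by (auto simp: multilinear_def tuples_def)
  let ?f = "\<lambda>(v, a). a \<odot>\<^bsub>T\<^esub> pure R E []"
  have lf: "?f \<in> linear_maps R E T"
    using pc by (auto simp: linear_maps_def E_def unit_ext_def T.smult_l_distr T.smult_assoc1)
  have d: "lei_counit R V = tensor_lift R E T 1 (\<lambda>xs. ?f (hd xs))"
    unfolding lei_counit_def Let_def E_def T_def by simp
  note L = tensor_lift[OF E T.module_axioms multilinear_1[OF lf], folded d]
  show "lei_counit R V \<in> linear_maps R (tensor_power R E 1) T" by (rule L(1))
  show "lei_counit R V (pure R E [(v, \<zero>\<^bsub>R\<^esub>)]) = \<zero>\<^bsub>T\<^esub>" if "v \<in> carrier V" for v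
    using that pc by (subst L(2)) (auto simp: tuples_def E_def unit_ext_def)
  show "lei_counit R V (pure R E [u]) = pure R E []"
    using pc by (subst L(2)) (auto simp: tuples_def E_def unit_ext_def u_def unit_elt_def)
qed

lemma linear_mapsD:
  assumes "h \<in> linear_maps R M N"
  shows "x \<in> carrier M \<Longrightarrow> h x \<in> carrier N"
    and "x \<in> carrier M \<Longrightarrow> y \<in> carrier M \<Longrightarrow> h (x \<oplus>\<^bsub>M\<^esub> y) = h x \<oplus>\<^bsub>N\<^esub> h y"
    and "r \<in> carrier R \<Longrightarrow> x \<in> carrier M \<Longrightarrow> h (r \<odot>\<^bsub>M\<^esub> x) = r \<odot>\<^bsub>N\<^esub> h x"
  using assms unfolding linear_maps_def by (simp_all add: Pi_iff)

lemma bilinear_opD: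
  assumes "bilinear_op R V br"
  shows "v \<in> carrier V \<Longrightarrow> w \<in> carrier V \<Longrightarrow> br v w \<in> carrier V"
    and "v \<in> carrier V \<Longrightarrow> w \<in> carrier V \<Longrightarrow> v' \<in> carrier V \<Longrightarrow> br (v \<oplus>\<^bsub>V\<^esub> v') w = br v w \<oplus>\<^bsub>V\<^esub> br v' w"
    and "v \<in> carrier V \<Longrightarrow> w \<in> carrier V \<Longrightarrow> v' \<in> carrier V \<Longrightarrow> br w (v \<oplus>\<^bsub>V\<^esub> v') = br w v \<oplus>\<^bsub>V\<^esub> br w v'"
    and "v \<in> carrier V \<Longrightarrow> w \<in> carrier V \<Longrightarrow> r \<in> carrier R \<Longrightarrow> br (r \<odot>\<^bsub>V\<^esub> v) w = r \<odot>\<^bsub>V\<^esub> br v w"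
    and "v \<in> carrier V \<Longrightarrow> w \<in> carrier V \<Longrightarrow> r \<in> carrier R \<Longrightarrow> br w (r \<odot>\<^bsub>V\<^esub> v) = r \<odot>\<^bsub>V\<^esub> br w v"
proof -
  have l: "(\<lambda>y. br x y) \<in> linear_maps R V V" "(\<lambda>y. br y x) \<in> linear_maps R V V" if "x \<in> carrier V" for x
    using assms that by (simp_all add: bilinear_op_def)
  note D = linear_mapsD[OF l(1)] linear_mapsD[OF l(2)]
  show "v \<in> carrier V \<Longrightarrow> w \<in> carrier V \<Longrightarrow> br v w \<in> carrier V"
    "v \<in> carrier V \<Longrightarrow> w \<in> carrier V \<Longrightarrow> v' \<in> carrier V \<Longrightarrow> br (v \<oplus>\<^bsub>V\<^esub> v') w = br v w \<oplus>\<^bsub>V\<^esub> br v' w"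
    "v \<in> carrier V \<Longrightarrow> w \<in> carrier V \<Longrightarrow> v' \<in> carrier V \<Longrightarrow> br w (v \<oplus>\<^bsub>V\<^esub> v') = br w v \<oplus>\<^bsub>V\<^esub> br w v'"
    "v \<in> carrier V \<Longrightarrow> w \<in> carrier V \<Longrightarrow> r \<in> carrier R \<Longrightarrow> br (r \<odot>\<^bsub>V\<^esub> v) w = r \<odot>\<^bsub>V\<^esub> br v w"
    "v \<in> carrier V \<Longrightarrow> w \<in> carrier V \<Longrightarrow> r \<in> carrier R \<Longrightarrow> br w (r \<odot>\<^bsub>V\<^esub> v) = r \<odot>\<^bsub>V\<^esub> br w v"
    by (rule D, assumption+)+
qed

lemma lei_op_values:
  assumes "module R V" "bilinear_op R V br"
  defines "E \<equiv> unit_ext R V" and "u \<equiv> unit_elt R V"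
  shows "\<And>v w. v \<in> carrier V \<Longrightarrow> w \<in> carrier V \<Longrightarrow>
      lei_op R V br (v, \<zero>\<^bsub>R\<^esub>) (w, \<zero>\<^bsub>R\<^esub>) = (br v w, \<zero>\<^bsub>R\<^esub>)"
    and "\<And>v w. v \<in> carrier V \<Longrightarrow> w \<in> carrier V \<Longrightarrow>
      lei_op_tilde R V br (v, \<zero>\<^bsub>R\<^esub>) (w, \<zero>\<^bsub>R\<^esub>) = (\<ominus>\<^bsub>V\<^esub> br v w, \<zero>\<^bsub>R\<^esub>)"
    and "\<And>x. x \<in> carrier E \<Longrightarrow> lei_op R V br x u = x"
    and "\<And>x. x \<in> carrier E \<Longrightarrow> lei_op_tilde R V br x u = x"
    and "\<And>v. v \<in> carrier V \<Longrightarrow> lei_op R V br u (v, \<zero>\<^bsub>R\<^esub>) = \<zero>\<^bsub>E\<^esub>"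
    and "\<And>v. v \<in> carrier V \<Longrightarrow> lei_op_tilde R V br u (v, \<zero>\<^bsub>R\<^esub>) = \<zero>\<^bsub>E\<^esub>"
    and "bilinear_op R E (lei_op R V br)"
    and "bilinear_op R E (lei_op_tilde R V br)"
proof -
  interpret module R V by fact
  note cl = bilinear_opD(1)[OF assms(2)] and b = bilinear_opD(2-5)[OF assms(2)]
  have z: "br v \<zero>\<^bsub>V\<^esub> = \<zero>\<^bsub>V\<^esub>" "br \<zero>\<^bsub>V\<^esub> v = \<zero>\<^bsub>V\<^esub>" if "v \<in> carrier V" for v
    using b(3)[OF M.zero_closed that R.zero_closed] b(4)[OF M.zero_closed that R.zero_closed] that cl by simp_all
  note [simp] = E_def u_def unit_ext_def unit_elt_def lei_op_def lei_op_tilde_def cl z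
  show "lei_op R V br (v, \<zero>\<^bsub>R\<^esub>) (w, \<zero>\<^bsub>R\<^esub>) = (br v w, \<zero>\<^bsub>R\<^esub>)"
    "lei_op_tilde R V br (v, \<zero>\<^bsub>R\<^esub>) (w, \<zero>\<^bsub>R\<^esub>) = (\<ominus>\<^bsub>V\<^esub> br v w, \<zero>\<^bsub>R\<^esub>)"
    if "v \<in> carrier V" "w \<in> carrier V" for v w using that by auto
  show "lei_op R V br x u = x" "lei_op_tilde R V br x u = x" if "x \<in> carrier E" for x
    using that by auto
  show "lei_op R V br u (v, \<zero>\<^bsub>R\<^esub>) = \<zero>\<^bsub>E\<^esub>" "lei_op_tilde R V br u (v, \<zero>\<^bsub>R\<^esub>) = \<zero>\<^bsub>E\<^esub>"
    if "v \<in> carrier V" for v using that by auto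
  have comm: "r \<odot>\<^bsub>V\<^esub> (b \<odot>\<^bsub>V\<^esub> v) = b \<odot>\<^bsub>V\<^esub> (r \<odot>\<^bsub>V\<^esub> v)" if "r \<in> carrier R" "b \<in> carrier R" "v \<in> carrier V" for r b v
    using that by (metis R.m_comm smult_assoc1)
  note S = smult_l_distr smult_r_distr smult_assoc1 R.l_distr R.r_distr R.m_ac M.a_ac b comm M.minus_add smult_r_minus
  show "bilinear_op R E (lei_op R V br)" "bilinear_op R E (lei_op_tilde R V br)"
    unfolding bilinear_op_def linear_maps_def by (auto simp: S)
qed

end

theory Submission
  imports Defs
begin

text \<open>
  The module \<open>V \<oplus> R\<one>\<close> is generated by \<open>\<one>\<close> and the elements of \<open>V\<close>, so two linear maps on a tensor
  power agree as soon as they agree on pure tensors of such generators. There every axiom is a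
  finite computation, as \<open>\<Delta>\<close> is group-like on \<open>\<one>\<close> and primitive on \<open>V\<close>. The only case in which
  generalized self-distributivity is not automatic is \<open>v \<otimes> w \<otimes> u\<close> with all three factors in \<open>V\<close>:
  it reads \<open>[[v, w], u] = [v, [w, u]] + [[v, u], w]\<close>, where tensors of degree one can be
  compared because \<open>x \<mapsto> pure [x]\<close> is injective.
\<close>

section \<open>Linear and multilinear maps\<close>

lemma generated_submodule_least:
  "submodule N R M \<Longrightarrow> G \<subseteq> N \<Longrightarrow> generated_submodule R M G \<subseteq> N"
  by (auto simp: generated_submodule_def)

lemma linear_maps_id: "(\<lambda>x. x) \<in> linear_maps R M M"
  by (simp add: linear_maps_def)

lemma linear_maps_comp:
  "g \<in> linear_maps R N P \<Longrightarrow> f \<in> linear_maps R M N \<Longrightarrow> g \<circ> f \<in> linear_maps R M P"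
  by (auto simp: linear_maps_def Pi_iff)

lemma linear_maps_add:
  assumes "module R N" "f \<in> linear_maps R M N" "g \<in> linear_maps R M N"
  shows "(\<lambda>x. f x \<oplus>\<^bsub>N\<^esub> g x) \<in> linear_maps R M N"
proof -
  interpret N: module R N by fact
  show ?thesis
    using linear_mapsD[OF assms(2)] linear_mapsD[OF assms(3)]
    by (auto simp: linear_maps_def N.smult_r_distr N.M.a_ac)
qed

lemma linear_maps_minus:
  assumes "module R M" "module R N" "h \<in> linear_maps R M N" "x \<in> carrier M" "y \<in> carrier M"
  shows "h (x \<ominus>\<^bsub>M\<^esub> y) = h x \<ominus>\<^bsub>N\<^esub> h y"
proof -
  interpret M: module R M by fact
  show ?thesis
    using linear_mapsD(2)[OF assms(3), of x "\<ominus>\<^bsub>M\<^esub> y"] linear_kernel(2)[OF assms(1-3)] assms(4,5)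
    by (simp add: a_minus_def)
qed

lemma linear_maps_zero:
  assumes "module R M" "module R N" "h \<in> linear_maps R M N"
  shows "h \<zero>\<^bsub>M\<^esub> = \<zero>\<^bsub>N\<^esub>"
proof -
  interpret M: module R M by fact
  interpret N: module R N by fact
  show ?thesis
    using linear_mapsD(3)[OF assms(3) M.R.zero_closed M.M.zero_closed] linear_mapsD(1)[OF assms(3) M.M.zero_closed]
    by simp
qed

text \<open>The tool for arguing on generators: a linear map that sends generators into
  \<open>K\<close> has a preimage of \<open>K\<close> containing them, and as a submodule this
  preimage contains everything that they generate.\<close>

lemma submodule_vimage:
  assumes M: "module R M" and N: "module R N" and h: "h \<in> linear_maps R M N" and K: "submodule K R N"
  shows "submodule {x \<in> carrier M. h x \<in> K} R M"
proof -
  interpret M: module R M by fact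
  interpret N: module R N by fact
  show ?thesis
    by (rule M.submoduleI)
      (use N.submoduleE[OF K] subgroup.one_closed[OF submodule.axioms(1)[OF K]] linear_mapsD[OF h]
        linear_kernel(2)[OF M N h] linear_maps_zero[OF M N h] in \<open>simp_all add: subset_iff\<close>)
qed

lemma multilinear_comp:
  assumes "multilinear R M N n f" "h \<in> linear_maps R N P"
  shows "multilinear R M P n (\<lambda>xs. h (f xs))"
  unfolding multilinear_def
proof (intro conjI allI impI)
  show "(\<lambda>xs. h (f xs)) \<in> tuples M n \<rightarrow> carrier P"
    using assms(1) linear_mapsD(1)[OF assms(2)] by (auto simp: multilinear_def)
  fix xs ys assume "set (xs @ ys) \<subseteq> carrier M" "length xs + 1 + length ys = n"
  then have "(\<lambda>x. f (xs @ x # ys)) \<in> linear_maps R M N"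
    using assms(1) unfolding multilinear_def by blast
  from linear_maps_comp[OF assms(2) this] show "(\<lambda>x. h (f (xs @ x # ys))) \<in> linear_maps R M P"
    by (simp add: comp_def)
qed

text \<open>A slot lies either among the first \<open>m\<close> entries or behind them. In both
  cases one factor is constant, and linearity of \<open>b\<close> in the other factor
  applies.\<close>

lemma multilinear_bilinear:
  assumes f: "multilinear R M N m f" and g: "multilinear R M N' n g"
    and b1: "\<And>y. y \<in> carrier N' \<Longrightarrow> (\<lambda>x. b x y) \<in> linear_maps R N P"
    and b2: "\<And>x. x \<in> carrier N \<Longrightarrow> (\<lambda>y. b x y) \<in> linear_maps R N' P"
  shows "multilinear R M P (m + n) (\<lambda>xs. b (f (take m xs)) (g (drop m xs)))"
proof -
  have fc: "f xs \<in> carrier N" if "set xs \<subseteq> carrier M" "length xs = m" for xs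
    using f that by (auto simp: multilinear_def tuples_def)
  have gc: "g xs \<in> carrier N'" if "set xs \<subseteq> carrier M" "length xs = n" for xs
    using g that by (auto simp: multilinear_def tuples_def)
  show ?thesis
    unfolding multilinear_def
  proof (intro conjI allI impI)
    show "(\<lambda>xs. b (f (take m xs)) (g (drop m xs))) \<in> tuples M (m + n) \<rightarrow> carrier P"
    proof
      fix xs assume "xs \<in> tuples M (m + n)"
      then have "f (take m xs) \<in> carrier N" "g (drop m xs) \<in> carrier N'"
        by (auto intro!: fc gc simp: tuples_def dest: in_set_takeD in_set_dropD)
      then show "b (f (take m xs)) (g (drop m xs)) \<in> carrier P" by (rule linear_mapsD(1)[OF b2])
    qed
  next
    fix xs ys assume s: "set (xs @ ys) \<subseteq> carrier M" and l: "length xs + 1 + length ys = m + n"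
    show "(\<lambda>x. b (f (take m (xs @ x # ys))) (g (drop m (xs @ x # ys)))) \<in> linear_maps R M P"
    proof (cases "length xs < m")
      case True
      \<comment> \<open>The slot itself takes one of the places left in the first block, so exactly
        \<open>k\<close> entries of \<open>ys\<close> still belong to \<open>f\<close>.\<close>
      then obtain k where k: "m - length xs = Suc k" by (metis Suc_diff_Suc)
      have c: "g (drop k ys) \<in> carrier N'"
        using s l k by (intro gc) (auto dest: in_set_dropD)
      have "set (xs @ take k ys) \<subseteq> carrier M" "length xs + 1 + length (take k ys) = m"
        using s l k by (auto dest: in_set_takeD)
      then have "(\<lambda>x. f (xs @ x # take k ys)) \<in> linear_maps R M N"
        using f unfolding multilinear_def by blast
      from linear_maps_comp[OF b1[OF c] this] show ?thesis using True k by (simp add: comp_def)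
    next
      case False
      have c: "f (take m xs) \<in> carrier N"
        using s l False by (intro fc) (auto dest: in_set_takeD)
      have "set (drop m xs @ ys) \<subseteq> carrier M" "length (drop m xs) + 1 + length ys = n"
        using s l False by (auto dest: in_set_dropD)
      then have "(\<lambda>x. g (drop m xs @ x # ys)) \<in> linear_maps R M N'"
        using g unfolding multilinear_def by blast
      from linear_maps_comp[OF b2[OF c] this] show ?thesis using False by (simp add: comp_def)
    qed
  qed
qed

section \<open>Testing equality of linear maps on generators\<close>

lemma set_length_cases:
  assumes "set xs \<subseteq> S" "length xs = n"
  shows "n = 1 \<Longrightarrow> \<exists>x\<in>S. xs = [x]"
    and "n = 2 \<Longrightarrow> \<exists>x\<in>S. \<exists>y\<in>S. xs = [x, y]"
    and "n = 3 \<Longrightarrow> \<exists>x\<in>S. \<exists>y\<in>S. \<exists>z\<in>S. xs = [x, y, z]"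
  using assms by (auto simp: length_Suc_conv numeral_2_eq_2 numeral_3_eq_3)

text \<open>Multilinearity extends the equality from entries in \<open>S\<close> to arbitrary
  entries, one slot at a time. Uniqueness in \<open>tensor_lift_unique\<close> then carries it from
  pure tensors to the whole tensor power.\<close>

lemma eq_on_powerI:
  assumes M: "module R M" and N: "module R N"
    and f: "f \<in> linear_maps R (tensor_power R M n) N" and g: "g \<in> linear_maps R (tensor_power R M n) N"
    and S: "S \<subseteq> carrier M" "generated_submodule R M S = carrier M"
    and eq: "\<And>xs. set xs \<subseteq> S \<Longrightarrow> length xs = n \<Longrightarrow> f (pure R M xs) = g (pure R M xs)"
  shows "eq_on_power R M n f g"
proof -
  note ml = multilinear_comp[OF pure_multilinear[OF M, of n]]
  have eq': "f (pure R M (xs @ ys)) = g (pure R M (xs @ ys))"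
    if "set xs \<subseteq> carrier M" "set ys \<subseteq> S" "length xs + length ys = n" for xs ys
    using that
  \<comment> \<open>The entries of \<open>xs\<close> are arbitrary, those of \<open>ys\<close> are
    generators. For the last entry \<open>x\<close> of the prefix, linearity in its slot allows the
    assumption that \<open>x\<close> lies in \<open>S\<close>; it then joins the suffix and the
    induction hypothesis applies.\<close>
  proof (induction xs arbitrary: ys rule: rev_induct)
    case Nil
    then show ?case using eq by simp
  next
    case (snoc x xs)
    have "set (xs @ ys) \<subseteq> carrier M" "length xs + 1 + length ys = n" using snoc.prems S by auto
    then have l: "(\<lambda>x. f (pure R M (xs @ x # ys))) \<in> linear_maps R M N"
      "(\<lambda>x. g (pure R M (xs @ x # ys))) \<in> linear_maps R M N"
      using ml[OF f] ml[OF g] unfolding multilinear_def by blast+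
    have "f (pure R M (xs @ x # ys)) = g (pure R M (xs @ x # ys))"
      by (rule linear_ext[OF M N l S]) (use snoc in auto)
    then show ?case by simp
  qed
  let ?T = "carrier (tensor_power R M n)"
  \<comment> \<open>Uniqueness of the lift is stated among maps that are extensional on the carrier,
    so both maps are first cut down to it.\<close>
  have r: "restrict h ?T \<in> linear_maps R (tensor_power R M n) N \<and> restrict h ?T \<in> extensional ?T \<and>
      (\<forall>xs\<in>tuples M n. restrict h ?T (pure R M xs) = f (pure R M xs))"
    if h: "h \<in> linear_maps R (tensor_power R M n) N"
      and e: "\<And>xs. xs \<in> tuples M n \<Longrightarrow> h (pure R M xs) = f (pure R M xs)" for h
  proof (intro conjI ballI)
    interpret module R "tensor_power R M n" by (rule tensor_power_facts(2)[OF M])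
    show "restrict h ?T \<in> linear_maps R (tensor_power R M n) N" using h by (auto simp: linear_maps_def)
    show "restrict h ?T (pure R M xs) = f (pure R M xs)" if "xs \<in> tuples M n" for xs
      using e[OF that] pure_multilinear[OF M, of n] that by (auto simp: multilinear_def)
  qed simp
  have gf: "g (pure R M xs) = f (pure R M xs)" if "xs \<in> tuples M n" for xs
    using eq'[of xs "[]"] that by (simp add: tuples_def)
  have "restrict f ?T = restrict g ?T"
    by (rule Uniq_D[where P = "\<lambda>h. h \<in> linear_maps R (tensor_power R M n) N \<and> h \<in> extensional ?T \<and>
          (\<forall>xs\<in>tuples M n. h (pure R M xs) = f (pure R M xs))",
          OF conjunct2[OF tensor_lift_unique[OF M N ml[OF f], unfolded ex1_iff_ex_Uniq]] r[OF f refl] r[OF g gf]])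
  then show ?thesis unfolding eq_on_power_def by (metis restrict_apply')
qed

section \<open>Products of tensors and of maps\<close>

context module
begin

section \<open>Formal combinations of tuples and the product of tensors\<close>

abbreviation TF where "TF n \<equiv> tuple_module R M n"
abbreviation TR where "TR n \<equiv> multilinear_relations R M n"
abbreviation TP where "TP n \<equiv> tensor_power R M n"

text \<open>The product of representatives inside \<open>tensor_mult\<close>. With a name of its
  own, it can be shown to be linear and compatible with the relations before passing to
  cosets.\<close>

definition conc where "conc m p q = (\<lambda>zs. p (take m zs) \<otimes>\<^bsub>R\<^esub> q (drop m zs))"

lemma TF_module: "module R (TF n)"
  by (rule free_module_module) (rule R.is_cring)

lemma TP_module: "module R (TP n)"
  by (rule tensor_power_facts(2)) (rule module_axioms)

lemma TF_gen: "set xs \<subseteq> carrier M \<Longrightarrow> length xs = n \<Longrightarrow> free_gen R xs \<in> carrier (TF n)"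
  by (rule free_gen_carrier[OF R.is_cring]) (simp add: tuples_def)

lemma TP_coset:
  shows "p \<in> carrier (TF n) \<Longrightarrow> q \<in> carrier (TF n) \<Longrightarrow>
      (TR n +>\<^bsub>TF n\<^esub> p) \<oplus>\<^bsub>TP n\<^esub> (TR n +>\<^bsub>TF n\<^esub> q) = TR n +>\<^bsub>TF n\<^esub> (p \<oplus>\<^bsub>TF n\<^esub> q)"
    and "r \<in> carrier R \<Longrightarrow> p \<in> carrier (TF n) \<Longrightarrow>
      r \<odot>\<^bsub>TP n\<^esub> (TR n +>\<^bsub>TF n\<^esub> p) = TR n +>\<^bsub>TF n\<^esub> (r \<odot>\<^bsub>TF n\<^esub> p)"
    and "carrier (TP n) = (\<lambda>p. TR n +>\<^bsub>TF n\<^esub> p) ` carrier (TF n)"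
  using quotient_module_module(2-)[OF TF_module tensor_power_facts(1)[OF module_axioms], folded tensor_power_def]
  by blast+

lemma conc_closed:
  assumes p: "p \<in> carrier (TF m)" and q: "q \<in> carrier (TF n)"
  shows "conc m p q \<in> carrier (TF (m + n))"
proof -
  have c: "p x \<in> carrier R" "q x \<in> carrier R" for x using p q by (auto simp: free_module_def)
  \<comment> \<open>A list in the support splits at \<open>m\<close> into members of the two
    supports, so the support is covered by the image of a finite product.\<close>
  have "{zs. conc m p q zs \<noteq> \<zero>\<^bsub>R\<^esub>} \<subseteq>
      (\<lambda>(xs, ys). xs @ ys) ` ({xs. p xs \<noteq> \<zero>\<^bsub>R\<^esub>} \<times> {ys. q ys \<noteq> \<zero>\<^bsub>R\<^esub>})"
  proof
    fix zs assume "zs \<in> {zs. conc m p q zs \<noteq> \<zero>\<^bsub>R\<^esub>}"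
    then have "p (take m zs) \<noteq> \<zero>\<^bsub>R\<^esub>" "q (drop m zs) \<noteq> \<zero>\<^bsub>R\<^esub>" using c by (auto simp: conc_def)
    then show "zs \<in> (\<lambda>(xs, ys). xs @ ys) ` ({xs. p xs \<noteq> \<zero>\<^bsub>R\<^esub>} \<times> {ys. q ys \<noteq> \<zero>\<^bsub>R\<^esub>})"
      by (intro image_eqI[of _ _ "(take m zs, drop m zs)"]) (auto simp: conc_def)
  qed
  then have f: "finite {zs. conc m p q zs \<noteq> \<zero>\<^bsub>R\<^esub>}"
    by (rule finite_subset) (use p q in \<open>auto simp: free_module_def\<close>)
  have "conc m p q zs = \<zero>\<^bsub>R\<^esub>" if "zs \<notin> tuples M (m + n)" for zs
  proof -
    \<comment> \<open>By contraposition, a list outside \<open>tuples M (m + n)\<close> has a half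
      that is not a tuple of the right kind, and there \<open>p\<close> or \<open>q\<close>
      vanishes.\<close>
    have "zs \<in> tuples M (m + n)" if "take m zs \<in> tuples M m" "drop m zs \<in> tuples M n"
      using that append_take_drop_id[of m zs] unfolding tuples_def mem_Collect_eq
      by (metis Un_least length_append set_append)
    then have "p (take m zs) = \<zero>\<^bsub>R\<^esub> \<or> q (drop m zs) = \<zero>\<^bsub>R\<^esub>" using that p q by (auto simp: free_module_def)
    then show ?thesis using c by (auto simp: conc_def)
  qed
  then show ?thesis using f c by (simp add: conc_def free_module_def)
qed

lemma conc_linear:
  shows "q \<in> carrier (TF n) \<Longrightarrow> (\<lambda>p. conc m p q) \<in> linear_maps R (TF m) (TF (m + n))"
    and "p \<in> carrier (TF m) \<Longrightarrow> (\<lambda>q. conc m p q) \<in> linear_maps R (TF n) (TF (m + n))"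
proof -
  have comm: "x \<otimes>\<^bsub>R\<^esub> (r \<otimes>\<^bsub>R\<^esub> y) = r \<otimes>\<^bsub>R\<^esub> (x \<otimes>\<^bsub>R\<^esub> y)"
    if "x \<in> carrier R" "y \<in> carrier R" "r \<in> carrier R" for x y r
    using that by (simp add: R.m_lcomm)
  have c: "p xs \<in> carrier R" if "p \<in> carrier (TF k)" for p k xs using that by (auto simp: free_module_def)
  have op: "(p \<oplus>\<^bsub>TF k\<^esub> q) xs = p xs \<oplus>\<^bsub>R\<^esub> q xs" "(r \<odot>\<^bsub>TF k\<^esub> p) xs = r \<otimes>\<^bsub>R\<^esub> p xs" for p q r k xs
    by (simp_all add: free_module_def)
  show "(\<lambda>p. conc m p q) \<in> linear_maps R (TF m) (TF (m + n))" if "q \<in> carrier (TF n)"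
    using that by (auto simp: linear_maps_def conc_closed[unfolded conc_def] c op conc_def R.l_distr R.m_assoc fun_eq_iff)
  show "(\<lambda>q. conc m p q) \<in> linear_maps R (TF n) (TF (m + n))" if "p \<in> carrier (TF m)"
    using that by (auto simp: linear_maps_def conc_closed[unfolded conc_def] c op conc_def R.r_distr comm fun_eq_iff)
qed

lemma conc_free_gen:
  assumes "length xs = m"
  shows "conc m (free_gen R xs) (free_gen R ys) = free_gen R (xs @ ys)"
proof (rule ext)
  fix zs
  have "zs = xs @ ys \<longleftrightarrow> take m zs = xs \<and> drop m zs = ys"
    using assms by (metis append_eq_conv_conj append_take_drop_id)
  then show "conc m (free_gen R xs) (free_gen R ys) zs = free_gen R (xs @ ys) zs"
    by (simp add: free_gen_def conc_def)
qed

text \<open>The relations are generated by two families, so by linearity of \<open>h\<close> only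
  these have to be sent into \<open>K\<close>. The hypotheses apply \<open>h\<close> to single
  tuples, which is computable at once when \<open>h\<close> is concatenation with a fixed
  tuple.\<close>

lemma relations_least:
  assumes "module R N" "h \<in> linear_maps R (TF n) N" "submodule K R N"
    and "\<And>xs x y ys. x \<in> carrier M \<Longrightarrow> y \<in> carrier M \<Longrightarrow> set xs \<subseteq> carrier M \<Longrightarrow> set ys \<subseteq> carrier M
      \<Longrightarrow> length xs + 1 + length ys = n \<Longrightarrow>
      h (free_gen R (xs @ (x \<oplus>\<^bsub>M\<^esub> y) # ys)) \<ominus>\<^bsub>N\<^esub> (h (free_gen R (xs @ x # ys)) \<oplus>\<^bsub>N\<^esub> h (free_gen R (xs @ y # ys))) \<in> K"
    and "\<And>xs r x ys. r \<in> carrier R \<Longrightarrow> x \<in> carrier M \<Longrightarrow> set xs \<subseteq> carrier M \<Longrightarrow> set ys \<subseteq> carrier M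
      \<Longrightarrow> length xs + 1 + length ys = n \<Longrightarrow>
      h (free_gen R (xs @ (r \<odot>\<^bsub>M\<^esub> x) # ys)) \<ominus>\<^bsub>N\<^esub> (r \<odot>\<^bsub>N\<^esub> h (free_gen R (xs @ x # ys))) \<in> K"
    and p: "p \<in> TR n"
  shows "h p \<in> K"
proof -
  interpret F: module R "TF n" by (rule TF_module)
  note lin = linear_maps_minus[OF TF_module assms(1,2)] linear_mapsD[OF assms(2)]
  have 1: "free_gen R (xs @ (x \<oplus>\<^bsub>M\<^esub> y) # ys) \<ominus>\<^bsub>TF n\<^esub>
      (free_gen R (xs @ x # ys) \<oplus>\<^bsub>TF n\<^esub> free_gen R (xs @ y # ys)) \<in> {p \<in> carrier (TF n). h p \<in> K}"
    if "x \<in> carrier M" "y \<in> carrier M" "set xs \<subseteq> carrier M" "set ys \<subseteq> carrier M"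
      "length xs + 1 + length ys = n" for xs x y ys
  proof -
    have "free_gen R (xs @ z # ys) \<in> carrier (TF n)" if "z \<in> carrier M" for z
      using that \<open>set xs \<subseteq> _\<close> \<open>set ys \<subseteq> _\<close> \<open>_ = n\<close> by (intro TF_gen) auto
    then show ?thesis using assms(4)[OF that] that by (simp add: lin)
  qed
  have 2: "free_gen R (xs @ (r \<odot>\<^bsub>M\<^esub> x) # ys) \<ominus>\<^bsub>TF n\<^esub> (r \<odot>\<^bsub>TF n\<^esub> free_gen R (xs @ x # ys))
      \<in> {p \<in> carrier (TF n). h p \<in> K}"
    if "r \<in> carrier R" "x \<in> carrier M" "set xs \<subseteq> carrier M" "set ys \<subseteq> carrier M"
      "length xs + 1 + length ys = n" for xs r x ys
  proof -
    have "free_gen R (xs @ z # ys) \<in> carrier (TF n)" if "z \<in> carrier M" for z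
      using that \<open>set xs \<subseteq> _\<close> \<open>set ys \<subseteq> _\<close> \<open>_ = n\<close> by (intro TF_gen) auto
    then show ?thesis using assms(5)[OF that] that by (simp add: lin)
  qed
  have "TR n \<subseteq> {p \<in> carrier (TF n). h p \<in> K}"
    unfolding multilinear_relations_def
    by (rule generated_submodule_least[OF submodule_vimage[OF TF_module assms(1-3)]])
      (use 1 2 in auto)
  then show ?thesis using p by auto
qed

lemma relation_add:
  assumes "x \<in> carrier M" "y \<in> carrier M" "set xs \<subseteq> carrier M" "set ys \<subseteq> carrier M"
    "length xs + 1 + length ys = n"
  shows "free_gen R (xs @ (x \<oplus>\<^bsub>M\<^esub> y) # ys) \<ominus>\<^bsub>TF n\<^esub>
      (free_gen R (xs @ x # ys) \<oplus>\<^bsub>TF n\<^esub> free_gen R (xs @ y # ys)) \<in> TR n"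
  unfolding multilinear_relations_def
  by (rule subsetD[OF generated_submodule_incl], rule UnI1) (use assms in fastforce)

lemma relation_smult:
  assumes "r \<in> carrier R" "x \<in> carrier M" "set xs \<subseteq> carrier M" "set ys \<subseteq> carrier M"
    "length xs + 1 + length ys = n"
  shows "free_gen R (xs @ (r \<odot>\<^bsub>M\<^esub> x) # ys) \<ominus>\<^bsub>TF n\<^esub> (r \<odot>\<^bsub>TF n\<^esub> free_gen R (xs @ x # ys)) \<in> TR n"
  unfolding multilinear_relations_def
  by (rule subsetD[OF generated_submodule_incl], rule UnI2) (use assms in fastforce)

text \<open>Single tuples generate the free module; a claim of the form \<open>h p \<in> K\<close>
  with \<open>h\<close> linear is thus reduced to them.\<close>

lemma TF_induct:
  assumes "module R N" "h \<in> linear_maps R (TF n) N" "submodule K R N"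
    and "\<And>xs. xs \<in> tuples M n \<Longrightarrow> h (free_gen R xs) \<in> K" and "p \<in> carrier (TF n)"
  shows "h p \<in> K"
proof -
  have "generated_submodule R (TF n) (free_gen R ` tuples M n) \<subseteq> {p \<in> carrier (TF n). h p \<in> K}"
    by (rule generated_submodule_least[OF submodule_vimage[OF TF_module assms(1-3)]])
      (use assms(4) free_gen_carrier[OF R.is_cring] in auto)
  then show ?thesis using assms(5) by (auto simp: free_gen_generates[OF R.is_cring])
qed

text \<open>The relations behave like a two-sided ideal for concatenation. Linearity reduces the
  arbitrary factor to a single tuple, and putting a fixed tuple before or after a generating
  relation gives a generating relation between longer tuples.\<close>

lemma conc_relations:
  shows "p \<in> TR m \<Longrightarrow> q \<in> carrier (TF n) \<Longrightarrow> conc m p q \<in> TR (m + n)"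
    and "p \<in> carrier (TF m) \<Longrightarrow> q \<in> TR n \<Longrightarrow> conc m p q \<in> TR (m + n)"
proof -
  note S = tensor_power_facts(1)[OF module_axioms, of "m + n"]
  have sub: "TR k \<subseteq> carrier (TF k)" for k
    using module.submoduleE(1)[OF TF_module tensor_power_facts(1)[OF module_axioms]] .
  show "conc m p q \<in> TR (m + n)" if p: "p \<in> TR m" and q: "q \<in> carrier (TF n)"
  proof (rule TF_induct[OF TF_module conc_linear(2) S _ q])
    fix ys assume "ys \<in> tuples M n"
    then have ys: "set ys \<subseteq> carrier M" "length ys = n" by (auto simp: tuples_def)
    show "conc m p (free_gen R ys) \<in> TR (m + n)"
      by (rule relations_least[OF TF_module conc_linear(1) S _ _ p])
        (use ys relation_add[of _ _ _ "_ @ ys" "m + n"] relation_smult[of _ _ _ "_ @ ys" "m + n"]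
          in \<open>auto simp: conc_free_gen TF_gen\<close>)
  qed (use p sub in auto)
  show "conc m p q \<in> TR (m + n)" if p: "p \<in> carrier (TF m)" and q: "q \<in> TR n"
  proof (rule TF_induct[OF TF_module conc_linear(1) S _ p])
    fix ys assume "ys \<in> tuples M m"
    then have ys: "set ys \<subseteq> carrier M" "length ys = m" by (auto simp: tuples_def)
    show "conc m (free_gen R ys) q \<in> TR (m + n)"
      by (rule relations_least[OF TF_module conc_linear(2) S _ _ q])
        (use ys relation_add[of _ _ "ys @ _" _ "m + n"] relation_smult[of _ _ "ys @ _" _ "m + n"]
          in \<open>auto simp: conc_free_gen TF_gen\<close>)
  qed (use q sub in auto)
qed

text \<open>The union defining \<open>tensor_mult\<close> runs over all pairs of representatives. It
  is a single coset because a change of representatives alters the product only by a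
  relation.\<close>

lemma tensor_mult_coset:
  assumes p: "p \<in> carrier (TF m)" and q: "q \<in> carrier (TF n)"
  shows "tensor_mult R M m n (TR m +>\<^bsub>TF m\<^esub> p) (TR n +>\<^bsub>TF n\<^esub> q) = TR (m + n) +>\<^bsub>TF (m + n)\<^esub> conc m p q"
proof -
  have sg: "abelian_subgroup (TR k) (TF k)" for k
  proof -
    interpret F: module R "TF k" by (rule TF_module)
    interpret submodule "TR k" R "TF k" by (rule tensor_power_facts(1)[OF module_axioms])
    show ?thesis
      by (rule abelian_subgroupI3) (simp_all add: additive_subgroup_def subgroup_axioms F.abelian_group_axioms)
  qed
  interpret Fm: module R "TF m" by (rule TF_module)
  interpret Fn: module R "TF n" by (rule TF_module)
  interpret F: module R "TF (m + n)" by (rule TF_module)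
  interpret Km: abelian_subgroup "TR m" "TF m" by (rule sg)
  interpret Kn: abelian_subgroup "TR n" "TF n" by (rule sg)
  interpret K: abelian_subgroup "TR (m + n)" "TF (m + n)" by (rule sg)
  have "TR (m + n) +>\<^bsub>TF (m + n)\<^esub> conc m p' q' = TR (m + n) +>\<^bsub>TF (m + n)\<^esub> conc m p q"
    if p': "p' \<in> TR m +>\<^bsub>TF m\<^esub> p" and q': "q' \<in> TR n +>\<^bsub>TF n\<^esub> q" for p' q'
  proof -
    obtain k where k: "k \<in> TR m" "p' = k \<oplus>\<^bsub>TF m\<^esub> p" using p' by (auto simp: a_r_coset_def')
    obtain l where l: "l \<in> TR n" "q' = l \<oplus>\<^bsub>TF n\<^esub> q" using q' by (auto simp: a_r_coset_def')
    have c: "k \<in> carrier (TF m)" "l \<in> carrier (TF n)" "q' \<in> carrier (TF n)"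
      using k l q Km.a_subset Kn.a_subset by auto
    \<comment> \<open>Here \<open>k\<close> and \<open>l\<close> are the changes of representatives.
      The first two summands are relations by \<open>conc_relations\<close>, so only
      \<open>conc m p q\<close> counts modulo relations.\<close>
    have "conc m p' q' = conc m k q' \<oplus>\<^bsub>TF (m + n)\<^esub> (conc m p l \<oplus>\<^bsub>TF (m + n)\<^esub> conc m p q)"
      using linear_mapsD(2)[OF conc_linear(1)[OF c(3), of m] c(1) p]
        linear_mapsD(2)[OF conc_linear(2)[OF p, of n] c(2) q] unfolding k(2) l(2) by (simp only:)
    also have "\<dots> = (conc m k q' \<oplus>\<^bsub>TF (m + n)\<^esub> conc m p l) \<oplus>\<^bsub>TF (m + n)\<^esub> conc m p q"
      using p q c by (simp add: F.a_assoc conc_closed)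
    finally have "conc m p' q' \<in> TR (m + n) +>\<^bsub>TF (m + n)\<^esub> conc m p q"
      using conc_relations(1)[OF k(1) c(3)] conc_relations(2)[OF p l(1)] K.a_closed
      unfolding a_r_coset_def' by blast
    then show ?thesis using K.a_repr_independence' conc_closed[OF p q] by metis
  qed
  moreover have "p \<in> TR m +>\<^bsub>TF m\<^esub> p" "q \<in> TR n +>\<^bsub>TF n\<^esub> q"
    using Km.a_rcos_self[OF p] Kn.a_rcos_self[OF q] by auto
  ultimately show ?thesis unfolding tensor_mult_def conc_def[symmetric] by blast
qed

text \<open>The module operations on cosets are computed on representatives, so linearity descends
  from \<open>conc\<close>.\<close>

lemma tensor_mult_linear:
  shows "B \<in> carrier (TP n) \<Longrightarrow> (\<lambda>A. tensor_mult R M m n A B) \<in> linear_maps R (TP m) (TP (m + n))"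
    and "A \<in> carrier (TP m) \<Longrightarrow> (\<lambda>B. tensor_mult R M m n A B) \<in> linear_maps R (TP n) (TP (m + n))"
proof -
  interpret Fm: module R "TF m" by (rule TF_module)
  interpret Fn: module R "TF n" by (rule TF_module)
  have coset: "\<exists>p\<in>carrier (TF k). A = TR k +>\<^bsub>TF k\<^esub> p" if "A \<in> carrier (TP k)" for A k
    using that by (auto simp: TP_coset(3))
  have closed: "tensor_mult R M m n A B \<in> carrier (TP (m + n))"
    if AB: "A \<in> carrier (TP m)" "B \<in> carrier (TP n)" for A B
  proof -
    obtain p q where "p \<in> carrier (TF m)" "A = TR m +>\<^bsub>TF m\<^esub> p" "q \<in> carrier (TF n)" "B = TR n +>\<^bsub>TF n\<^esub> q"
      using coset[OF AB(1)] coset[OF AB(2)] by blast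
    then show ?thesis using conc_closed by (simp add: tensor_mult_coset TP_coset(3))
  qed
  show "(\<lambda>A. tensor_mult R M m n A B) \<in> linear_maps R (TP m) (TP (m + n))" if B: "B \<in> carrier (TP n)"
    unfolding linear_maps_def
  proof (intro CollectI conjI ballI)
    obtain q where q: "q \<in> carrier (TF n)" "B = TR n +>\<^bsub>TF n\<^esub> q" using coset[OF B] by blast
    note D = linear_mapsD[OF conc_linear(1)[OF q(1), of m]]
    fix A assume "A \<in> carrier (TP m)"
    then obtain p where p: "p \<in> carrier (TF m)" "A = TR m +>\<^bsub>TF m\<^esub> p" using coset by blast
    { fix A' assume "A' \<in> carrier (TP m)"
      then obtain p' where p': "p' \<in> carrier (TF m)" "A' = TR m +>\<^bsub>TF m\<^esub> p'" using coset by blast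
      show "tensor_mult R M m n (A \<oplus>\<^bsub>TP m\<^esub> A') B =
          tensor_mult R M m n A B \<oplus>\<^bsub>TP (m + n)\<^esub> tensor_mult R M m n A' B"
        using p(1) p'(1) q(1)
        by (simp only: p(2) p'(2) q(2) TP_coset tensor_mult_coset D conc_closed Fm.add.m_closed) }
    fix r assume "r \<in> carrier R"
    then show "tensor_mult R M m n (r \<odot>\<^bsub>TP m\<^esub> A) B = r \<odot>\<^bsub>TP (m + n)\<^esub> tensor_mult R M m n A B"
      using p(1) q(1)
      by (simp only: p(2) q(2) TP_coset tensor_mult_coset D conc_closed Fm.smult_closed)
  qed (use closed[OF _ B] in auto)
  show "(\<lambda>B. tensor_mult R M m n A B) \<in> linear_maps R (TP n) (TP (m + n))" if A: "A \<in> carrier (TP m)"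
    unfolding linear_maps_def
  proof (intro CollectI conjI ballI)
    obtain p where p: "p \<in> carrier (TF m)" "A = TR m +>\<^bsub>TF m\<^esub> p" using coset[OF A] by blast
    note D = linear_mapsD[OF conc_linear(2)[OF p(1), of n]]
    fix B assume "B \<in> carrier (TP n)"
    then obtain q where q: "q \<in> carrier (TF n)" "B = TR n +>\<^bsub>TF n\<^esub> q" using coset by blast
    { fix B' assume "B' \<in> carrier (TP n)"
      then obtain q' where q': "q' \<in> carrier (TF n)" "B' = TR n +>\<^bsub>TF n\<^esub> q'" using coset by blast
      show "tensor_mult R M m n A (B \<oplus>\<^bsub>TP n\<^esub> B') =
          tensor_mult R M m n A B \<oplus>\<^bsub>TP (m + n)\<^esub> tensor_mult R M m n A B'"
        using p(1) q'(1) q(1)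
        by (simp only: p(2) q'(2) q(2) TP_coset tensor_mult_coset D conc_closed Fn.add.m_closed) }
    fix r assume "r \<in> carrier R"
    then show "tensor_mult R M m n A (r \<odot>\<^bsub>TP n\<^esub> B) = r \<odot>\<^bsub>TP (m + n)\<^esub> tensor_mult R M m n A B"
      using p(1) q(1)
      by (simp only: p(2) q(2) TP_coset tensor_mult_coset D conc_closed Fn.smult_closed)
  qed (use closed[OF A] in auto)
qed

lemma tensor_mult_pure:
  assumes "set xs \<subseteq> carrier M" "set ys \<subseteq> carrier M" "length xs = m" "length ys = n"
  shows "tensor_mult R M m n (pure R M xs) (pure R M ys) = pure R M (xs @ ys)"
  using assms tensor_mult_coset[of "free_gen R xs" m "free_gen R ys" n]
  by (simp add: pure_def TF_gen conc_free_gen)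

section \<open>Tensor products of maps and maps acting at a position\<close>

lemma tensor_map_multilinear:
  assumes f: "f \<in> linear_maps R (TP l) (TP r)" and g: "g \<in> linear_maps R (TP l') (TP r')"
  shows "multilinear R M (TP (r + r')) (l + l')
    (\<lambda>xs. tensor_mult R M r r' (f (pure R M (take l xs))) (g (pure R M (drop l xs))))"
  \<comment> \<open>Each factor is multilinear in its own block of entries, and the product of
    tensors is bilinear. This is what lets \<open>tensor_lift\<close> pick out a map in the
    definition of \<open>tensor_map\<close>.\<close>
  by (rule multilinear_bilinear[OF multilinear_comp[OF pure_multilinear[OF module_axioms] f]
        multilinear_comp[OF pure_multilinear[OF module_axioms] g] tensor_mult_linear])

text \<open>The total degrees are variables tied by equations, so that the rule also applies where
  they appear as numerals.\<close>

lemma tensor_map_linear: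
  assumes "f \<in> linear_maps R (TP l) (TP r)" "g \<in> linear_maps R (TP l') (TP r')"
    and "l + l' = n" "r + r' = n'"
  shows "tensor_map R M l r l' r' f g \<in> linear_maps R (TP n) (TP n')"
  unfolding tensor_map_def assms(3,4)[symmetric]
  by (rule tensor_lift(1)[OF module_axioms TP_module tensor_map_multilinear[OF assms(1,2)]])

lemma tensor_map_pure:
  assumes "f \<in> linear_maps R (TP l) (TP r)" "g \<in> linear_maps R (TP l') (TP r')"
    and "set xs \<subseteq> carrier M" "length xs = l + l'"
  shows "tensor_map R M l r l' r' f g (pure R M xs) =
    tensor_mult R M r r' (f (pure R M (take l xs))) (g (pure R M (drop l xs)))"
  unfolding tensor_map_def
  by (rule tensor_lift(2)[OF module_axioms TP_module tensor_map_multilinear[OF assms(1,2)]])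
    (use assms(3,4) in \<open>simp add: tuples_def\<close>)

lemma at_pos_linear:
  assumes "f \<in> linear_maps R (TP l) (TP r)" "1 \<le> i" "i \<le> k + 1" "k + l = n" "k + r = n'"
  shows "at_pos R M l r k i f \<in> linear_maps R (TP n) (TP n')"
  unfolding at_pos_def
  \<comment> \<open>The bounds on \<open>i\<close> ensure \<open>(i - 1) + (k + 1 - i) = k\<close>
    for truncated subtraction, so the degrees add up.\<close>
  by (rule tensor_map_linear[OF linear_maps_id tensor_map_linear[OF assms(1) linear_maps_id refl refl]])
    (use assms(2-5) in auto)

lemma at_pos_pure:
  assumes "f \<in> linear_maps R (TP l) (TP r)" "1 \<le> i" "i \<le> k + 1"
    and "set xs \<subseteq> carrier M" "length xs = k + l"
  shows "at_pos R M l r k i f (pure R M xs) =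
    tensor_mult R M (i - 1) (r + (k + 1 - i)) (pure R M (take (i - 1) xs))
      (tensor_mult R M r (k + 1 - i) (f (pure R M (take l (drop (i - 1) xs))))
        (pure R M (drop l (drop (i - 1) xs))))"
proof -
  have "at_pos R M l r k i f (pure R M xs) =
      tensor_mult R M (i - 1) (r + (k + 1 - i)) (pure R M (take (i - 1) xs))
        (tensor_map R M l r (k + 1 - i) (k + 1 - i) f (\<lambda>t. t) (pure R M (drop (i - 1) xs)))"
    unfolding at_pos_def
    by (rule tensor_map_pure[OF linear_maps_id tensor_map_linear[OF assms(1) linear_maps_id refl refl] assms(4)])
      (use assms(2,3,5) in auto)
  moreover have "tensor_map R M l r (k + 1 - i) (k + 1 - i) f (\<lambda>t. t) (pure R M (drop (i - 1) xs)) =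
      tensor_mult R M r (k + 1 - i) (f (pure R M (take l (drop (i - 1) xs))))
        (pure R M (drop l (drop (i - 1) xs)))"
    by (rule tensor_map_pure[OF assms(1) linear_maps_id])
      (use assms(2-5) set_drop_subset[of "i - 1" xs] in auto)
  ultimately show ?thesis by (simp only:)
qed

lemma pure_closed:
  "set xs \<subseteq> carrier M \<Longrightarrow> length xs = n \<Longrightarrow> pure R M xs \<in> carrier (TP n)"
  using pure_multilinear[OF module_axioms, of n] by (auto simp: multilinear_def tuples_def)

lemma pure_slot_linear:
  assumes "set xs \<subseteq> carrier M" "set ys \<subseteq> carrier M" "length xs + 1 + length ys = n"
  shows "(\<lambda>x. pure R M (xs @ x # ys)) \<in> linear_maps R M (TP n)"
  using pure_multilinear[OF module_axioms, of n] assms unfolding multilinear_def by simp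

text \<open>A pure tensor is linear in the slot that contains the zero entry.\<close>

lemma pure_zero:
  assumes "set xs \<subseteq> carrier M" "\<zero>\<^bsub>M\<^esub> \<in> set xs"
  shows "pure R M xs = \<zero>\<^bsub>TP (length xs)\<^esub>"
proof -
  obtain ys zs where "xs = ys @ \<zero>\<^bsub>M\<^esub> # zs" using assms(2) by (meson split_list)
  then show ?thesis
    using linear_maps_zero[OF module_axioms TP_module pure_slot_linear[of ys zs "length xs"]] assms(1) by auto
qed

text \<open>The lift of the identity of \<open>M\<close> is a left inverse of
  \<open>x \<mapsto> pure R M [x]\<close>. This brings an equation between tensors of degree one
  back to the module itself.\<close>

lemma pure_single_inj:
  assumes "x \<in> carrier M" "y \<in> carrier M" "pure R M [x] = pure R M [y]"
  shows "x = y"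
proof -
  have "tensor_lift R M M 1 hd (pure R M [z]) = z" if "z \<in> carrier M" for z
    using tensor_lift(2)[OF module_axioms module_axioms multilinear_1[OF linear_maps_id], of "[z]"] that
    by (simp add: tuples_def)
  then show ?thesis using assms by metis
qed

section \<open>The flip and binary operations as linear maps on tensor powers\<close>

lemma multilinear_2:
  assumes b: "\<And>y. y \<in> carrier M \<Longrightarrow> (\<lambda>x. b x y) \<in> linear_maps R M N"
    "\<And>x. x \<in> carrier M \<Longrightarrow> (\<lambda>y. b x y) \<in> linear_maps R M N"
  shows "multilinear R M N 2 (\<lambda>xs. b (xs ! 0) (xs ! 1))"
  unfolding multilinear_def
proof (intro conjI allI impI)
  show "(\<lambda>xs. b (xs ! 0) (xs ! 1)) \<in> tuples M 2 \<rightarrow> carrier N"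
    using linear_mapsD(1)[OF b(1)] by (auto simp: tuples_def numeral_2_eq_2 length_Suc_conv)
  fix xs ys assume s: "set (xs @ ys) \<subseteq> carrier M" and l: "length xs + 1 + length ys = 2"
  from l consider y where "xs = []" "ys = [y]" | x where "xs = [x]" "ys = []"
    by (cases xs; cases ys) auto
  then show "(\<lambda>x. b ((xs @ x # ys) ! 0) ((xs @ x # ys) ! 1)) \<in> linear_maps R M N"
    using s b by cases simp_all
qed

lemma flip_map_multilinear: "multilinear R M (TP 2) 2 (\<lambda>xs. pure R M [xs ! 1, xs ! 0])"
  using pure_slot_linear[of "[_]" "[]" 2] pure_slot_linear[of "[]" "[_]" 2]
  by (intro multilinear_2) simp_all

lemma flip_map:
  shows "flip_map R M \<in> linear_maps R (TP 2) (TP 2)"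
    and "x \<in> carrier M \<Longrightarrow> y \<in> carrier M \<Longrightarrow> flip_map R M (pure R M [x, y]) = pure R M [y, x]"
  unfolding flip_map_def
  using tensor_lift[OF module_axioms TP_module flip_map_multilinear] by (simp_all add: tuples_def)

lemma op_map_multilinear:
  assumes f: "bilinear_op R M f"
  shows "multilinear R M (TP 1) 2 (\<lambda>xs. pure R M [f (xs ! 0) (xs ! 1)])"
proof -
  have l: "(\<lambda>x. pure R M [x]) \<in> linear_maps R M (TP 1)" using pure_slot_linear[of "[]" "[]" 1] by simp
  show ?thesis
    by (rule multilinear_2[where b = "\<lambda>x y. pure R M [f x y]"])
      (use f linear_maps_comp[OF l, of "f _" M] linear_maps_comp[OF l, of "\<lambda>x. f x _" M]
        in \<open>simp_all add: bilinear_op_def comp_def\<close>)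
qed

lemma op_map:
  assumes "bilinear_op R M f"
  shows "op_map R M f \<in> linear_maps R (TP 2) (TP 1)"
    and "x \<in> carrier M \<Longrightarrow> y \<in> carrier M \<Longrightarrow> op_map R M f (pure R M [x, y]) = pure R M [f x y]"
  unfolding op_map_def
  using tensor_lift[OF module_axioms TP_module op_map_multilinear[OF assms]] by (simp_all add: tuples_def)

section \<open>Additivity rules for evaluating composites\<close>

lemma tensor_mult_add:
  shows "A \<in> carrier (TP m) \<Longrightarrow> A' \<in> carrier (TP m) \<Longrightarrow> B \<in> carrier (TP n) \<Longrightarrow>
      tensor_mult R M m n (A \<oplus>\<^bsub>TP m\<^esub> A') B =
        tensor_mult R M m n A B \<oplus>\<^bsub>TP (m + n)\<^esub> tensor_mult R M m n A' B"
    and "A \<in> carrier (TP m) \<Longrightarrow> B \<in> carrier (TP n) \<Longrightarrow> B' \<in> carrier (TP n) \<Longrightarrow>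
      tensor_mult R M m n A (B \<oplus>\<^bsub>TP n\<^esub> B') =
        tensor_mult R M m n A B \<oplus>\<^bsub>TP (m + n)\<^esub> tensor_mult R M m n A B'"
  by (rule linear_mapsD(2)[OF tensor_mult_linear(1)] linear_mapsD(2)[OF tensor_mult_linear(2)]; assumption)+

lemma tensor_mult_zero:
  shows "B \<in> carrier (TP n) \<Longrightarrow> tensor_mult R M m n \<zero>\<^bsub>TP m\<^esub> B = \<zero>\<^bsub>TP (m + n)\<^esub>"
    and "A \<in> carrier (TP m) \<Longrightarrow> tensor_mult R M m n A \<zero>\<^bsub>TP n\<^esub> = \<zero>\<^bsub>TP (m + n)\<^esub>"
  by (rule linear_maps_zero[OF TP_module TP_module tensor_mult_linear(1)]
      linear_maps_zero[OF TP_module TP_module tensor_mult_linear(2)]; assumption)+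

text \<open>The degree of the argument is kept apart as \<open>n\<close> with the side condition
  \<open>n = k + l\<close>; as a rewrite rule this matches sums in a tensor power whose degree is a
  numeral.\<close>

lemma at_pos_add:
  assumes "f \<in> linear_maps R (TP l) (TP r)" "1 \<le> i" "i \<le> k + 1" "n = k + l"
    and "x \<in> carrier (TP n)" "y \<in> carrier (TP n)"
  shows "at_pos R M l r k i f (x \<oplus>\<^bsub>TP n\<^esub> y) =
    at_pos R M l r k i f x \<oplus>\<^bsub>TP (k + r)\<^esub> at_pos R M l r k i f y"
  using linear_mapsD(2)[OF at_pos_linear[OF assms(1-3) refl refl]] assms(4-6) by simp

lemma at_pos_zero:
  assumes "f \<in> linear_maps R (TP l) (TP r)" "1 \<le> i" "i \<le> k + 1" "n = k + l"
  shows "at_pos R M l r k i f \<zero>\<^bsub>TP n\<^esub> = \<zero>\<^bsub>TP (k + r)\<^esub>"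
  using linear_maps_zero[OF TP_module TP_module at_pos_linear[OF assms(1-3) refl refl]] assms(4) by simp

lemma tensor_map_add:
  assumes "f \<in> linear_maps R (TP l) (TP r)" "g \<in> linear_maps R (TP l') (TP r')" "n = l + l'"
    and "x \<in> carrier (TP n)" "y \<in> carrier (TP n)"
  shows "tensor_map R M l r l' r' f g (x \<oplus>\<^bsub>TP n\<^esub> y) =
    tensor_map R M l r l' r' f g x \<oplus>\<^bsub>TP (r + r')\<^esub> tensor_map R M l r l' r' f g y"
  using linear_mapsD(2)[OF tensor_map_linear[OF assms(1,2) refl refl]] assms(3-5) by simp

end

section \<open>The rack structure on \<open>V \<oplus> R\<one>\<close>\<close>

locale bracket_module = module R V for R (structure) and V (structure) +
  fixes br
  assumes br: "bilinear_op R V br"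
begin

abbreviation E where "E \<equiv> unit_ext R V"
abbreviation u where "u \<equiv> unit_elt R V"
abbreviation inc where "inc v \<equiv> (v, \<zero>\<^bsub>R\<^esub>)"
abbreviation D where "D \<equiv> lei_comult R V"
abbreviation e where "e \<equiv> lei_counit R V"
abbreviation s where "s \<equiv> op_map R E (lei_op R V br)"
abbreviation s' where "s' \<equiv> op_map R E (lei_op_tilde R V br)"

sublocale E: module R E
  by (rule unit_ext_module) (rule module_axioms)

abbreviation gens where "gens \<equiv> insert u (inc ` carrier V)"

lemma E_carrier: "u \<in> carrier E" "inc v \<in> carrier E \<longleftrightarrow> v \<in> carrier V"
  by (auto simp: unit_ext_def unit_elt_def)

lemma E_add: "inc v \<oplus>\<^bsub>E\<^esub> inc w = inc (v \<oplus>\<^bsub>V\<^esub> w)" "inc \<zero>\<^bsub>V\<^esub> = \<zero>\<^bsub>E\<^esub>"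
  by (auto simp: unit_ext_def unit_elt_def)

lemma gens_generate: "generated_submodule R E gens = carrier E"
proof
  have sub: "gens \<subseteq> carrier E" by (auto simp: E_carrier)
  note sm = submodule_generated[OF E.module_axioms sub]
  show "generated_submodule R E gens \<subseteq> carrier E" by (rule E.submoduleE(1)[OF sm])
  show "carrier E \<subseteq> generated_submodule R E gens"
  proof
    fix x assume x: "x \<in> carrier E"
    obtain v a where va: "x = (v, a)" "v \<in> carrier V" "a \<in> carrier R" using x by (auto simp: unit_ext_def)
    then have "x = inc v \<oplus>\<^bsub>E\<^esub> a \<odot>\<^bsub>E\<^esub> u" by (simp add: unit_ext_def unit_elt_def)
    moreover have "inc v \<in> generated_submodule R E gens" "u \<in> generated_submodule R E gens"
      using generated_submodule_incl[of gens R E] va by auto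
    ultimately show "x \<in> generated_submodule R E gens"
      using E.submoduleE(4,5)[OF sm] va by simp
  qed
qed

lemma eq_on_power_gens:
  assumes "f \<in> linear_maps R (E.TP n) (E.TP k)" "g \<in> linear_maps R (E.TP n) (E.TP k)"
    and "\<And>xs. set xs \<subseteq> gens \<Longrightarrow> length xs = n \<Longrightarrow> f (pure R E xs) = g (pure R E xs)"
  shows "eq_on_power R E n f g"
  by (rule eq_on_powerI[OF E.module_axioms E.TP_module assms(1,2) _ gens_generate assms(3)])
    (auto simp: E_carrier)

section \<open>Evaluation of the structure maps on generators\<close>

lemmas D_lin = lei_comult_values(1)[OF module_axioms]
lemmas D_val = lei_comult_values(2,3)[OF module_axioms]
lemmas e_lin = lei_counit_values(1)[OF module_axioms]
lemmas e_val = lei_counit_values(2,3)[OF module_axioms]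
lemmas op_val = lei_op_values(1-6)[OF module_axioms br]
lemmas s_lin = E.op_map(1)[OF lei_op_values(7)[OF module_axioms br]]
lemmas s_val = E.op_map(2)[OF lei_op_values(7)[OF module_axioms br]]
lemmas s'_lin = E.op_map(1)[OF lei_op_values(8)[OF module_axioms br]]
lemmas s'_val = E.op_map(2)[OF lei_op_values(8)[OF module_axioms br]]

lemma lin_add:
  "x \<in> carrier (E.TP 2) \<Longrightarrow> y \<in> carrier (E.TP 2) \<Longrightarrow> s (x \<oplus>\<^bsub>E.TP 2\<^esub> y) = s x \<oplus>\<^bsub>E.TP 1\<^esub> s y"
  "x \<in> carrier (E.TP 2) \<Longrightarrow> y \<in> carrier (E.TP 2) \<Longrightarrow> s' (x \<oplus>\<^bsub>E.TP 2\<^esub> y) = s' x \<oplus>\<^bsub>E.TP 1\<^esub> s' y"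
  by (rule linear_mapsD(2)[OF s_lin] linear_mapsD(2)[OF s'_lin]; assumption)+

text \<open>Zero arguments stem from \<open>\<one> \<lhd> v = 0\<close>; \<open>D\<close> meets one
  in the composite \<open>D \<circ> s\<close>.\<close>

lemmas lin_zero = linear_maps_zero[OF E.TP_module E.TP_module D_lin]
  linear_maps_zero[OF E.TP_module E.TP_module s_lin]
  linear_maps_zero[OF E.TP_module E.TP_module s'_lin]

lemma pure_vals:
  "pure R E [] \<in> carrier (E.TP 0)"
  "x \<in> carrier E \<Longrightarrow> pure R E [x] \<in> carrier (E.TP 1)"
  "x \<in> carrier E \<Longrightarrow> y \<in> carrier E \<Longrightarrow> pure R E [x, y] \<in> carrier (E.TP 2)"
  "x \<in> carrier E \<Longrightarrow> y \<in> carrier E \<Longrightarrow> z \<in> carrier E \<Longrightarrow> pure R E [x, y, z] \<in> carrier (E.TP 3)"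
  "x \<in> carrier E \<Longrightarrow> y \<in> carrier E \<Longrightarrow> z \<in> carrier E \<Longrightarrow> w \<in> carrier E \<Longrightarrow>
    pure R E [x, y, z, w] \<in> carrier (E.TP 4)"
  by (rule E.pure_closed; simp)+

lemma pure_add:
  "x \<in> carrier E \<Longrightarrow> y \<in> carrier E \<Longrightarrow> pure R E [x] \<oplus>\<^bsub>E.TP 1\<^esub> pure R E [y] = pure R E [x \<oplus>\<^bsub>E\<^esub> y]"
  using linear_mapsD(2)[OF E.pure_slot_linear[of "[]" "[]" 1]] by simp

text \<open>As rewrite rules with a free degree, the last three normalize sums up to associativity
  and commutativity, so that both sides of an axiom turn into the same sum of pure tensors.\<close>

lemma TP_group:
  "\<zero>\<^bsub>E.TP n\<^esub> \<in> carrier (E.TP n)"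
  "x \<in> carrier (E.TP n) \<Longrightarrow> y \<in> carrier (E.TP n) \<Longrightarrow> x \<oplus>\<^bsub>E.TP n\<^esub> y \<in> carrier (E.TP n)"
  "x \<in> carrier (E.TP n) \<Longrightarrow> x \<oplus>\<^bsub>E.TP n\<^esub> \<zero>\<^bsub>E.TP n\<^esub> = x"
  "x \<in> carrier (E.TP n) \<Longrightarrow> \<zero>\<^bsub>E.TP n\<^esub> \<oplus>\<^bsub>E.TP n\<^esub> x = x"
  "x \<in> carrier (E.TP n) \<Longrightarrow> y \<in> carrier (E.TP n) \<Longrightarrow> x \<oplus>\<^bsub>E.TP n\<^esub> y = y \<oplus>\<^bsub>E.TP n\<^esub> x"
  "x \<in> carrier (E.TP n) \<Longrightarrow> y \<in> carrier (E.TP n) \<Longrightarrow> z \<in> carrier (E.TP n) \<Longrightarrow>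
    x \<oplus>\<^bsub>E.TP n\<^esub> (y \<oplus>\<^bsub>E.TP n\<^esub> z) = y \<oplus>\<^bsub>E.TP n\<^esub> (x \<oplus>\<^bsub>E.TP n\<^esub> z)"
  "x \<in> carrier (E.TP n) \<Longrightarrow> y \<in> carrier (E.TP n) \<Longrightarrow> z \<in> carrier (E.TP n) \<Longrightarrow>
    (x \<oplus>\<^bsub>E.TP n\<^esub> y) \<oplus>\<^bsub>E.TP n\<^esub> z = x \<oplus>\<^bsub>E.TP n\<^esub> (y \<oplus>\<^bsub>E.TP n\<^esub> z)"
proof -
  interpret T: module R "E.TP n" by (rule E.TP_module)
  show "\<zero>\<^bsub>E.TP n\<^esub> \<in> carrier (E.TP n)" by simp
qed (rule abelian_groupE abelian_monoid.a_closed abelian_monoid.r_zero abelian_monoid.l_zero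
  abelian_monoid.a_comm abelian_monoid.a_lcomm abelian_monoid.a_assoc;
  assumption?; (rule abelian_group.axioms(1) module.axioms(2) E.TP_module)+)+

lemma nat_numerals: "Suc (Suc 0) = 2" "Suc 2 = 3" "Suc 3 = 4"
  by simp_all

text \<open>
  The simplifier turns \<open>1\<close> into \<open>Suc 0\<close>, so the rules are unfolded accordingly and sums of
  \<open>Suc 0\<close> are brought back to numerals.
\<close>

lemmas evaluate = nat_numerals
  E.at_pos_pure[OF D_lin] E.at_pos_pure[OF s_lin] E.at_pos_pure[OF s'_lin] E.at_pos_pure[OF e_lin]
  E.at_pos_pure[OF E.flip_map(1)]
  E.at_pos_add[OF D_lin] E.at_pos_add[OF s_lin] E.at_pos_add[OF s'_lin] E.at_pos_add[OF e_lin]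
  E.at_pos_add[OF E.flip_map(1)]
  E.at_pos_zero[OF D_lin] E.at_pos_zero[OF s_lin] E.at_pos_zero[OF s'_lin]
  E.tensor_map_pure[OF s_lin s_lin] E.tensor_map_pure[OF D_lin D_lin] E.tensor_map_pure[OF linear_maps_id e_lin]
  E.tensor_map_add[OF s_lin s_lin] E.tensor_mult_add E.tensor_mult_zero E.tensor_mult_pure
  D_val e_val s_val s'_val op_val E.flip_map(2) lin_add lin_zero pure_vals TP_group E_carrier E_add(1)
  E.pure_zero bilinear_opD(1)[OF br] take_Cons' drop_Cons'

lemmas eval_simps = evaluate[unfolded One_nat_def]

section \<open>The axioms other than generalized self-distributivity\<close>

lemma coassociative:
  "eq_on_power R E 1 (at_pos R E 1 2 1 1 D \<circ> D) (at_pos R E 1 2 1 2 D \<circ> D)"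
proof (rule eq_on_power_gens[where k = 3])
  fix xs assume "set xs \<subseteq> gens" "length xs = 1"
  from set_length_cases(1)[OF this refl] obtain x where x: "xs = [x]" "x \<in> gens" by blast
  \<comment> \<open>On \<open>\<one>\<close> both sides are \<one> \<otimes> \<one> \<otimes>
    \<one>; on \<open>v\<close> both are the sum over the three places that \<open>v\<close> can
    take among units.\<close>
  from x(2) show "(at_pos R E 1 2 1 1 D \<circ> D) (pure R E xs) = (at_pos R E 1 2 1 2 D \<circ> D) (pure R E xs)"
    unfolding x(1) by (elim insertE imageE) (simp_all add: eval_simps)
qed (rule linear_maps_comp[OF E.at_pos_linear[OF D_lin] D_lin]; simp)+

lemma counital: "eq_on_power R E 1 (at_pos R E 1 0 1 2 e \<circ> D) (\<lambda>t. t)"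
proof (rule eq_on_power_gens[where k = 1])
  fix xs assume "set xs \<subseteq> gens" "length xs = 1"
  from set_length_cases(1)[OF this refl] obtain x where x: "xs = [x]" "x \<in> gens" by blast
  \<comment> \<open>For \<open>v\<close> the summand \<one> \<otimes> v is killed by the counit. In
    v \<otimes> \<one> the counit leaves the empty tuple, and \<open>[v] @ []\<close> is again
    \<open>[v]\<close>.\<close>
  from x(2) show "(at_pos R E 1 0 1 2 e \<circ> D) (pure R E xs) = pure R E xs"
    unfolding x(1) by (elim insertE imageE) (simp_all add: eval_simps)
qed (rule linear_maps_id linear_maps_comp[OF E.at_pos_linear[OF e_lin] D_lin]; simp)+

lemma compatible: "shelf_compatibility R E D s"
  unfolding shelf_compatibility_def comp_assoc
proof (rule eq_on_power_gens[where k = 2])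
  fix xs assume "set xs \<subseteq> gens" "length xs = 2"
  from set_length_cases(2)[OF this refl] obtain x y where x: "xs = [x, y]" "x \<in> gens" "y \<in> gens" by blast
  \<comment> \<open>On v \<otimes> w the right side has four terms. The two mixed ones contain the
    factor \<one> \<lhd> w = 0, and [v, w] \<otimes> \<one> + \<one> \<otimes> [v, w]
    remains.\<close>
  from x(2,3) show "(D \<circ> s) (pure R E xs) = (tensor_map R E 2 1 2 1 s s \<circ>
      (at_pos R E 2 2 2 2 (flip_map R E) \<circ> tensor_map R E 1 2 1 2 D D)) (pure R E xs)"
    unfolding x(1) by (elim insertE imageE) (simp_all add: eval_simps)
qed (rule linear_maps_comp[OF D_lin s_lin]
    linear_maps_comp[OF E.tensor_map_linear[OF s_lin s_lin]
      linear_maps_comp[OF E.at_pos_linear[OF E.flip_map(1)] E.tensor_map_linear[OF D_lin D_lin]]]; simp)+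

lemma cocommutative:
  "eq_on_power R E 1 (at_pos R E 2 2 2 2 (flip_map R E) \<circ> power_map R E 1 2 1 3 D) (power_map R E 1 2 1 3 D)"
proof -
  \<comment> \<open>The degree grows from 1 to 4, so the three factors carry 0, 1 and 2 identity
    factors in turn.\<close>
  have p: "power_map R E 1 2 1 3 D = at_pos R E 1 2 2 1 D \<circ> (at_pos R E 1 2 1 1 D \<circ> at_pos R E 1 2 0 1 D)"
    by (simp add: numeral_3_eq_3 comp_def) (simp add: nat_numerals)
  have l: "power_map R E 1 2 1 3 D \<in> linear_maps R (E.TP 1) (E.TP 4)"
    unfolding p
    by (rule linear_maps_comp[OF E.at_pos_linear[OF D_lin]
          linear_maps_comp[OF E.at_pos_linear[OF D_lin] E.at_pos_linear[OF D_lin]]]; simp)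
  show ?thesis
  proof (rule eq_on_power_gens[OF _ l])
    fix xs assume "set xs \<subseteq> gens" "length xs = 1"
    from set_length_cases(1)[OF this refl] obtain x where x: "xs = [x]" "x \<in> gens" by blast
    \<comment> \<open>The threefold power sends \<open>v\<close> to the sum over its four places
      among units; the flip only exchanges the terms with \<open>v\<close> in the second and third
      place.\<close>
    from x(2) show "(at_pos R E 2 2 2 2 (flip_map R E) \<circ> power_map R E 1 2 1 3 D) (pure R E xs) =
        power_map R E 1 2 1 3 D (pure R E xs)"
      unfolding x(1) p by (elim insertE imageE) (simp_all add: eval_simps)
  qed (rule linear_maps_comp[OF E.at_pos_linear[OF E.flip_map(1)] l]; simp)
qed

text \<open>Shared by the inverse axioms, with \<open>j = 1\<close> and \<open>k = 2\<close>, and by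
  the braiding, with \<open>j = 2\<close> and \<open>k = 1\<close>.\<close>

lemma shift_linear:
  assumes "f \<in> linear_maps R (E.TP 2) (E.TP 1)" and "1 \<le> j" "j \<le> 2" "1 \<le> k" "k \<le> 2"
  shows "at_pos R E 2 1 1 j f \<circ> (at_pos R E 2 2 1 k (flip_map R E) \<circ> at_pos R E 1 2 1 2 D)
    \<in> linear_maps R (E.TP 2) (E.TP 2)"
  by (rule linear_maps_comp[OF E.at_pos_linear[OF assms(1)]
        linear_maps_comp[OF E.at_pos_linear[OF E.flip_map(1)] E.at_pos_linear[OF D_lin]]])
    (use assms(2-5) in simp_all)

lemma counit_linear: "tensor_map R E 1 1 1 0 (\<lambda>t. t) e \<in> linear_maps R (E.TP 2) (E.TP 1)"
  by (rule E.tensor_map_linear[OF linear_maps_id e_lin]) simp_all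

lemma inverse: "rack_inverse R E D e s s'"
  unfolding rack_inverse_def comp_assoc
proof (intro conjI s'_lin)
  have neg: "\<ominus>\<^bsub>V\<^esub> br v w \<oplus>\<^bsub>V\<^esub> br v w = \<zero>\<^bsub>V\<^esub>" "br v w \<oplus>\<^bsub>V\<^esub> \<ominus>\<^bsub>V\<^esub> br v w = \<zero>\<^bsub>V\<^esub>"
    if "v \<in> carrier V" "w \<in> carrier V" for v w
    using bilinear_opD(1)[OF br that] by (simp_all add: M.l_neg M.r_neg)
  show "eq_on_power R E 2 (s' \<circ> (at_pos R E 2 1 1 1 s \<circ> (at_pos R E 2 2 1 2 (flip_map R E) \<circ> at_pos R E 1 2 1 2 D)))
      (tensor_map R E 1 1 1 0 (\<lambda>t. t) e)"
  proof (rule eq_on_power_gens[OF linear_maps_comp[OF s'_lin shift_linear[OF s_lin]] counit_linear])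
    fix xs assume "set xs \<subseteq> gens" "length xs = 2"
    from set_length_cases(2)[OF this refl] obtain x y where x: "xs = [x, y]" "x \<in> gens" "y \<in> gens" by blast
    \<comment> \<open>On v \<otimes> w the inner maps give v \<otimes> w + [v, w] \<otimes> \<one>,
      which \<open>s'\<close> sends to -[v, w] + [v, w]. This vanishes, as does the right side,
      since the counit is zero on \<open>w\<close>.\<close>
    from x(2,3) show "(s' \<circ> (at_pos R E 2 1 1 1 s \<circ> (at_pos R E 2 2 1 2 (flip_map R E) \<circ> at_pos R E 1 2 1 2 D)))
        (pure R E xs) = tensor_map R E 1 1 1 0 (\<lambda>t. t) e (pure R E xs)"
      unfolding x(1) by (elim insertE imageE) (simp_all add: eval_simps pure_add[unfolded One_nat_def] neg E_add(2))
  qed simp_all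
  show "eq_on_power R E 2 (s \<circ> (at_pos R E 2 1 1 1 s' \<circ> (at_pos R E 2 2 1 2 (flip_map R E) \<circ> at_pos R E 1 2 1 2 D)))
      (tensor_map R E 1 1 1 0 (\<lambda>t. t) e)"
  proof (rule eq_on_power_gens[OF linear_maps_comp[OF s_lin shift_linear[OF s'_lin]] counit_linear])
    fix xs assume "set xs \<subseteq> gens" "length xs = 2"
    from set_length_cases(2)[OF this refl] obtain x y where x: "xs = [x, y]" "x \<in> gens" "y \<in> gens" by blast
    from x(2,3) show "(s \<circ> (at_pos R E 2 1 1 1 s' \<circ> (at_pos R E 2 2 1 2 (flip_map R E) \<circ> at_pos R E 1 2 1 2 D)))
        (pure R E xs) = tensor_map R E 1 1 1 0 (\<lambda>t. t) e (pure R E xs)"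
      unfolding x(1) by (elim insertE imageE) (simp_all add: eval_simps pure_add[unfolded One_nat_def] neg E_add(2))
  qed simp_all
qed

lemma rack_except_GSD: "rack_except_GSD R E D e s s'"
  unfolding rack_except_GSD_def shelf_comultiplication_def rack_counit_def
  by (intro conjI E.module_axioms s_lin D_lin coassociative cocommutative compatible e_lin counital inverse)

section \<open>Generalized self-distributivity and the Leibniz condition\<close>

lemma gsd_iff_leibniz: "generalized_self_distributive R E D s \<longleftrightarrow> leibniz V br"
proof -
  let ?L = "power_map R E 2 1 3 2 s"
  let ?R = "s \<circ> (tensor_map R E 2 1 2 1 s s \<circ> (at_pos R E 2 2 2 2 (flip_map R E) \<circ> at_pos R E 1 2 2 3 D))"
  \<comment> \<open>From degree 3 the operation acts first beside one identity factor, then beside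
    none.\<close>
  have p: "?L = at_pos R E 2 1 0 1 s \<circ> at_pos R E 2 1 1 1 s"
    by (simp add: numeral_2_eq_2 comp_def)
  have lL: "?L \<in> linear_maps R (E.TP 3) (E.TP 1)"
    unfolding p by (rule linear_maps_comp[OF E.at_pos_linear[OF s_lin] E.at_pos_linear[OF s_lin]]; simp)
  have lR: "?R \<in> linear_maps R (E.TP 3) (E.TP 1)"
    by (rule linear_maps_comp[OF s_lin linear_maps_comp[OF E.tensor_map_linear[OF s_lin s_lin]
          linear_maps_comp[OF E.at_pos_linear[OF E.flip_map(1)] E.at_pos_linear[OF D_lin]]]]; simp)
  \<comment> \<open>Comultiplying the last factor and flipping gives v \<otimes> x \<otimes> w
    \<otimes> \<one> + v \<otimes> \<one> \<otimes> w \<otimes> x, hence [v, x] \<otimes> w + v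
    \<otimes> [w, x] after the two inner operations.\<close>
  have val: "?L (pure R E [inc v, inc w, inc x]) = pure R E [inc (br (br v w) x)]"
    "?R (pure R E [inc v, inc w, inc x]) = pure R E [inc (br v (br w x) \<oplus>\<^bsub>V\<^esub> br (br v x) w)]"
    if "v \<in> carrier V" "w \<in> carrier V" "x \<in> carrier V" for v w x
    unfolding p using that by (simp_all add: eval_simps pure_add[unfolded One_nat_def] M.a_comm)
  have cl: "br v w \<in> carrier V" if "v \<in> carrier V" "w \<in> carrier V" for v w
    using bilinear_opD(1)[OF br that] .
  \<comment> \<open>The subtracted term is moved across to match the shape of
    \<open>val\<close>.\<close>
  have leib: "leibniz V br \<longleftrightarrow> (\<forall>v\<in>carrier V. \<forall>w\<in>carrier V. \<forall>x\<in>carrier V.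
      br (br v w) x = br v (br w x) \<oplus>\<^bsub>V\<^esub> br (br v x) w)"
    unfolding leibniz_def
    by (intro ball_cong refl) (metis cl M.add.inv_solve_right a_minus_def)
  show ?thesis
  proof
    assume "generalized_self_distributive R E D s"
    then have eq: "?L t = ?R t" if "t \<in> carrier (E.TP 3)" for t
      using that unfolding generalized_self_distributive_def eq_on_power_def comp_assoc by blast
    have "br (br v w) x = br v (br w x) \<oplus>\<^bsub>V\<^esub> br (br v x) w"
      if vwx: "v \<in> carrier V" "w \<in> carrier V" "x \<in> carrier V" for v w x
    proof -
      have "pure R E [inc v, inc w, inc x] \<in> carrier (E.TP 3)" using vwx by (simp add: pure_vals E_carrier)
      from eq[OF this, unfolded val[OF vwx]]
      have "inc (br (br v w) x) = inc (br v (br w x) \<oplus>\<^bsub>V\<^esub> br (br v x) w)"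
        by (rule E.pure_single_inj[rotated 2]) (simp_all add: E_carrier vwx cl)
      then show ?thesis by simp
    qed
    then show "leibniz V br" unfolding leib by blast
  next
    assume "leibniz V br"
    \<comment> \<open>Both orders of the sum are supplied, since normalization may produce either
      one.\<close>
    then have L: "br v (br w x) \<oplus>\<^bsub>V\<^esub> br (br v x) w = br (br v w) x"
      "br (br v x) w \<oplus>\<^bsub>V\<^esub> br v (br w x) = br (br v w) x"
      if "v \<in> carrier V" "w \<in> carrier V" "x \<in> carrier V" for v w x
      using that cl M.a_comm unfolding leib by metis+
    show "generalized_self_distributive R E D s"
      unfolding generalized_self_distributive_def comp_assoc
    proof (rule eq_on_power_gens[OF lL lR])
      fix xs assume "set xs \<subseteq> gens" "length xs = 3"
      from set_length_cases(3)[OF this refl] obtain x y z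
        where x: "xs = [x, y, z]" "x \<in> gens" "y \<in> gens" "z \<in> gens" by blast
      from x(2-4) show "?L (pure R E xs) = ?R (pure R E xs)"
        unfolding x(1) p
        by (elim insertE imageE) (simp_all add: eval_simps pure_add[unfolded One_nat_def] L)
    qed
  qed
qed

section \<open>The braiding\<close>

lemma braiding: "eq_on_power R E 2 (rack_braiding R E D s) (bracket_braiding R V br)"
proof -
  let ?f = "\<lambda>a b. pure R E [b, a] \<oplus>\<^bsub>E.TP 2\<^esub> pure R E [u, bracket_ext R br a b]"
  have bx: "bilinear_op R E (bracket_ext R br)"
    using bilinear_opD[OF br]
    by (auto simp: bilinear_op_def linear_maps_def unit_ext_def bracket_ext_def)
  \<comment> \<open>This makes \<open>bracket_braiding\<close> an actual lift, with the values
    recorded in \<open>B\<close>.\<close>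
  have ml: "multilinear R E (E.TP 2) 2 (\<lambda>xs. ?f (xs ! 0) (xs ! 1))"
  proof (rule E.multilinear_2)
    have slot: "(\<lambda>x. pure R E [y, x]) \<in> linear_maps R E (E.TP 2)" "(\<lambda>x. pure R E [x, y]) \<in> linear_maps R E (E.TP 2)"
      if "y \<in> carrier E" for y
      using E.pure_slot_linear[of "[y]" "[]" 2] E.pure_slot_linear[of "[]" "[y]" 2] that by simp_all
    have b: "(\<lambda>x. bracket_ext R br x y) \<in> linear_maps R E E" "(\<lambda>x. bracket_ext R br y x) \<in> linear_maps R E E"
      if "y \<in> carrier E" for y
      using bx that by (simp_all add: bilinear_op_def)
    note ub = linear_maps_comp[OF slot(1)[OF E_carrier(1)], unfolded comp_def]
    show "(\<lambda>x. ?f x y) \<in> linear_maps R E (E.TP 2)" "(\<lambda>x. ?f y x) \<in> linear_maps R E (E.TP 2)"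
      if y: "y \<in> carrier E" for y
      by (rule linear_maps_add[OF E.TP_module slot(1)[OF y] ub[OF b(1)[OF y]]]
          linear_maps_add[OF E.TP_module slot(2)[OF y] ub[OF b(2)[OF y]]])+
  qed
  have d: "bracket_braiding R V br = tensor_lift R E (E.TP 2) 2 (\<lambda>xs. ?f (xs ! 0) (xs ! 1))"
    by (simp add: bracket_braiding_def Let_def)
  note B = tensor_lift[OF E.module_axioms E.TP_module ml, folded d]
  \<comment> \<open>The unit is \<open>(\<zero>, \<one>)\<close>, so a bracket with it is a bracket
    with zero in \<open>V\<close>. This is how the extended bracket comes to vanish on the
    unit.\<close>
  have zero: "br \<zero>\<^bsub>V\<^esub> v = \<zero>\<^bsub>V\<^esub>" "br v \<zero>\<^bsub>V\<^esub> = \<zero>\<^bsub>V\<^esub>" if "v \<in> carrier V" for v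
    using br that linear_maps_zero[OF module_axioms module_axioms, of "br v"]
      linear_maps_zero[OF module_axioms module_axioms, of "\<lambda>x. br x v"]
    by (simp_all add: bilinear_op_def)
  have b_val: "bracket_ext R br (inc v) (inc w) = inc (br v w)" "bracket_ext R br u (inc v) = \<zero>\<^bsub>E\<^esub>"
    "bracket_ext R br (inc v) u = \<zero>\<^bsub>E\<^esub>"
    if "v \<in> carrier V" "w \<in> carrier V" for v w
    using that zero by (simp_all add: bracket_ext_def unit_ext_def unit_elt_def)
  have "bracket_ext R br u u = \<zero>\<^bsub>E\<^esub>"
    using zero[OF M.zero_closed] by (simp add: bracket_ext_def unit_ext_def unit_elt_def)
  note b_val = b_val this
  show ?thesis
    unfolding rack_braiding_def comp_assoc
  proof (rule eq_on_power_gens[OF shift_linear[OF s_lin] B(1)])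
    fix xs assume "set xs \<subseteq> gens" "length xs = 2"
    from set_length_cases(2)[OF this refl] obtain x y where x: "xs = [x, y]" "x \<in> gens" "y \<in> gens" by blast
    then have "xs \<in> tuples E 2" by (auto simp: tuples_def E_carrier)
    note v = B(2)[OF this]
    \<comment> \<open>For \<open>w\<close> in \<open>V\<close>, a \<otimes> w goes to w \<otimes> a
      \<otimes> \<one> + \<one> \<otimes> a \<otimes> w and then to w \<otimes> a + \<one> \<otimes>
      (a \<lhd> w), where a \<lhd> w is the extended bracket. For a \<otimes> \<one> only \<one>
      \<otimes> a arises, and the bracket is zero.\<close>
    from x(2,3) show "(at_pos R E 2 1 1 2 s \<circ> (at_pos R E 2 2 1 1 (flip_map R E) \<circ> at_pos R E 1 2 1 2 D))
        (pure R E xs) = bracket_braiding R V br (pure R E xs)"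
      unfolding v unfolding x(1) by (elim insertE imageE) (simp_all add: eval_simps b_val)
  qed simp_all
qed

end

theorem proposition4p16:
  fixes R :: "('r, 'k) ring_scheme"
    and V :: "('r, 'v, 'm) module_scheme"
    and br :: "'v \<Rightarrow> 'v \<Rightarrow> 'v"
  assumes "cring R" and "module R V" and "bilinear_op R V br"
  defines "E \<equiv> unit_ext R V"
    and "D \<equiv> lei_comult R V"
    and "e \<equiv> lei_counit R V"
    and "s \<equiv> op_map R (unit_ext R V) (lei_op R V br)"
    and "s' \<equiv> op_map R (unit_ext R V) (lei_op_tilde R V br)"
  shows "rack_except_GSD R E D e s s'
    \<and> (generalized_self_distributive R E D s \<longleftrightarrow> leibniz V br)
    \<and> (leibniz V br \<longrightarrow> eq_on_power R E 2 (rack_braiding R E D s) (bracket_braiding R V br))"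
proof -
  interpret bracket_module R V br
    using assms(2,3) by (simp add: bracket_module_def bracket_module_axioms_def)
  show ?thesis
    unfolding assms(4-8) using rack_except_GSD gsd_iff_leibniz braiding by blast
qed

end
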